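(* Let $d\ge 2$, $r_o>0$, let $V\in W^{3,\infty}(\mathbb{B}^d_{r_o},\mathbb{R}^d)$ be a deformation field, and let $\sigma=\frac{n}{r_o}$ ($n\ge 0$ an integer) be a Steklov eigenvalue of the ball $\mathbb{B}^d_{r_o}$. Then the entries of the EMP matrix $M=M(\mathbb{B}^d_{r_o},V,\sigma)$, computed with the boundary-orthonormal basis $u_i=r_o^{-\frac{d-1}{2}}\left(\frac{r}{r_o}\right)^nY_n^i$, $1\le i\le N_{n,d}$, of the eigenspace of $\sigma$, are given by $$M_{i,j}=\sum_{\substack{l=0\\ l\ \mathrm{even}}}^{2n}\ \sum_{m=1}^{N_{l,d}}\alpha_{l,m,r_o}\,B(l,r_o)\int_{\mathbb{S}^{d-1}}Y_n^i\,\overline{Y_n^j}\,Y_l^m\,dS,\qquad B(l,r)=-\frac{1}{r^2}\left(\frac{l(l+d-2)}{2}+n\right),$$ where $\alpha_{l,m,r_o}$ are the coefficients of the Fourier-Laplace expansion $V_{n,r_o}=\sum_{l\ge0}\sum_{m=1}^{N_{l,d}}\alpha_{l,m,r_o}Y_l^m$ of the normal component of $V$ on $\mathbb{S}^{d-1}_{r_o}$, regarded as a function on $\mathbb{S}^{d-1}$.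
   Context: $\mathbb{B}^d_{r_o}=\{x\in\mathbb{R}^d:\|x\|<r_o\}$, $\mathbb{S}^{d-1}_{r_o}$ is its boundary, and $\mathbb{S}^{d-1}$ is the unit sphere. $\mathbb{Y}_l^d$ is the space of complex spherical harmonics of degree $l$ (restrictions to $\mathbb{S}^{d-1}$ of harmonic homogeneous polynomials of degree $l$ on $\mathbb{R}^d$), $N_{l,d}=\dim\mathbb{Y}_l^d$, and $\{Y_l^m: l\ge 0,\ 1\le m\le N_{l,d}\}$ is an arbitrary fixed $L^2(\mathbb{S}^{d-1})$-orthonormal basis of $\bigoplus_l\mathbb{Y}_l^d$ with $Y_l^m\in\mathbb{Y}_l^d$. Steklov eigenvalues of $\Omega$ are the numbers $\sigma$ such that $\Delta u=0$ in $\Omega$, $\partial_\nu u=\sigma u$ on $\partial\Omega$ ($\nu$ the outward unit normal) has a nontrivial solution $u$. The Steklov eigenvalues of $\mathbb{B}^d_{r_o}$ are $n/r_o$, $n=0,1,2,\dots$, with multiplicity $N_{n,d}$; the functions $u_i=r_o^{-(d-1)/2}(r/r_o)^nY_n^i$, $1\le i\le N_{n,d}$ (with $r=\|x\|$ and $Y_n^i$ evaluated at $x/\|x\|$), form a basis of the eigenspace that is orthonormal in $L^2(\partial\mathbb{B}^d_{r_o})$. EMP matrix: for a Steklov eigenvalue $\sigma$ of $\Omega$ of multiplicity $p$, with $L^2(\partial\Omega)$-orthonormal eigenbasis $u_1,\dots,u_p$, $M(\Omega,V,\sigma)$ is the $p\times p$ matrix with entries $$M_{ij}=\int_{\partial\Omega}\left(\nabla_\tau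 u_i\cdot\nabla_\tau\overline{u_j}-(\sigma^2+\sigma H)u_i\overline{u_j}\right)V_n\,dS,$$ where $\nabla_\tau$ is the tangential (surface) gradient, the dot denotes the bilinear dot product, $H$ is the additive curvature (sum of principal curvatures, equal to $(d-1)/r_o$ on $\mathbb{S}^{d-1}_{r_o}$), and $V_n=V\cdot\nu$. For the ball, $V_{n,r_o}(\theta)=V(r_o\theta)\cdot\theta$ for $\theta\in\mathbb{S}^{d-1}$. *)

theory Defs
  imports "HOL-Analysis.Analysis" "HOL-Library.Function_Algebras"
begin

section \<open>Partial derivatives and classes of smooth functions\<close>

definition partial_deriv ::
  "'a::euclidean_space \<Rightarrow> ('a \<Rightarrow> 'b::real_normed_vector) \<Rightarrow> 'a \<Rightarrow> 'b" where
  "partial_deriv b f x = frechet_derivative f (at x) b"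

text \<open>A multi-index of order k is encoded by a list of k basis vectors.\<close>

primrec iter_partial ::
  "'a::euclidean_space list \<Rightarrow> ('a \<Rightarrow> 'b::real_normed_vector) \<Rightarrow> 'a \<Rightarrow> 'b" where
  "iter_partial [] f = f"
| "iter_partial (b # bs) f = partial_deriv b (iter_partial bs f)"

definition C_k_on ::
  "nat \<Rightarrow> 'a::euclidean_space set \<Rightarrow> ('a \<Rightarrow> 'b::real_normed_vector) \<Rightarrow> bool" where
  "C_k_on k U f \<longleftrightarrow>
     (\<forall>bs. set bs \<subseteq> Basis \<and> length bs \<le> k \<longrightarrow> continuous_on U (iter_partial bs f)) \<and>
     (\<forall>bs. set bs \<subseteq> Basis \<and> length bs < k \<longrightarrow> (\<forall>x\<in>U. iter_partial bs f differentiable at x))"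

definition laplacian ::
  "('a::euclidean_space \<Rightarrow> 'b::real_normed_vector) \<Rightarrow> 'a \<Rightarrow> 'b" where
  "laplacian f x = (\<Sum>b\<in>Basis. iter_partial [b, b] f x)"

section \<open>The Sobolev spaces of essentially bounded functions\<close>

definition L_infinity ::
  "'a::euclidean_space set \<Rightarrow> ('a \<Rightarrow> 'b::euclidean_space) set" where
  "L_infinity U = {f. f \<in> borel_measurable (lebesgue_on U) \<and>
                      (\<exists>C. AE x in lebesgue_on U. norm (f x) \<le> C)}"

definition test_functions :: "'a::euclidean_space set \<Rightarrow> ('a \<Rightarrow> real) set" where
  "test_functions U = {\<phi>. (\<forall>k. C_k_on k UNIV \<phi>) \<and>
                          compact (closure {x. \<phi> x \<noteq> 0}) \<and> closure {x. \<phi> x \<noteq> 0} \<subseteq> U}"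

definition is_weak_derivative ::
  "'a::euclidean_space set \<Rightarrow> 'a list \<Rightarrow> ('a \<Rightarrow> 'b::euclidean_space) \<Rightarrow> ('a \<Rightarrow> 'b) \<Rightarrow> bool" where
  "is_weak_derivative U bs f g \<longleftrightarrow>
     (\<forall>\<phi>\<in>test_functions U.
        (LINT x|lebesgue_on U. iter_partial bs \<phi> x *\<^sub>R f x) =
        (- 1) ^ length bs *\<^sub>R (LINT x|lebesgue_on U. \<phi> x *\<^sub>R g x))"

definition Sobolev_infinity ::
  "nat \<Rightarrow> 'a::euclidean_space set \<Rightarrow> ('a \<Rightarrow> 'b::euclidean_space) set" where
  "Sobolev_infinity k U =
     {f. f \<in> L_infinity U \<and>
         (\<forall>bs. set bs \<subseteq> Basis \<and> length bs \<le> k \<longrightarrow>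
               (\<exists>g \<in> L_infinity U. is_weak_derivative U bs f g))}"

text \<open>
  An element of a Sobolev space is only determined almost everywhere, so its values on the
  boundary are those of its representative that is continuous up to the boundary. For a ball
  U and f in \<open>Sobolev_infinity k U\<close>, k > 0, such a representative exists (it is Lipschitz),
  and its values on \<open>closure U\<close> are unique.
\<close>

definition continuous_representative ::
  "'a::euclidean_space set \<Rightarrow> ('a \<Rightarrow> 'b::euclidean_space) \<Rightarrow> 'a \<Rightarrow> 'b" where
  "continuous_representative U f =
     (SOME g. continuous_on (closure U) g \<and> (AE x in lebesgue_on U. f x = g x))"

section \<open>Surface measure on spheres\<close>

text \<open>
  The measure of a Borel set A of the sphere of radius r is d/r times the volume of the part
  of the cone over A inside the ball of radius r (see the lemma below), that is, the
  (d-1)-dimensional surface area of A.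
\<close>

definition sphere_measure :: "real \<Rightarrow> 'a::euclidean_space measure" where
  "sphere_measure r =
     scale_measure (ennreal (real DIM('a) / r))
       (distr (restrict_space lborel (ball 0 r - {0})) (restrict_space borel (sphere 0 r))
          (\<lambda>x. r *\<^sub>R sgn x))"

lemma emeasure_sphere_measure:
  fixes A :: "'a::euclidean_space set"
  assumes r: "r > 0" and A: "A \<in> sets borel" "A \<subseteq> sphere 0 r"
  shows "emeasure (sphere_measure r) A =
    ennreal (real DIM('a) / r) * emeasure lborel {x \<in> ball 0 r - {0}. r *\<^sub>R sgn x \<in> A}"
proof -
  let ?B = "ball 0 r - {0} :: 'a set"
  have B: "?B \<in> sets borel" by auto
  have "(\<lambda>x::'a. r *\<^sub>R sgn x) \<in> borel_measurable borel"
    unfolding sgn_div_norm by measurable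
  then have m: "(\<lambda>x::'a. r *\<^sub>R sgn x)
      \<in> restrict_space lborel ?B \<rightarrow>\<^sub>M restrict_space borel (sphere 0 r)"
    using r by (intro measurable_restrict_space2 measurable_restrict_space1)
      (auto simp: space_restrict_space norm_sgn)
  have "A \<in> sets (restrict_space borel (sphere 0 r))"
    using A by (auto simp: sets_restrict_space)
  then have "emeasure (sphere_measure r) A = ennreal (real DIM('a) / r) *
      emeasure (restrict_space lborel ?B) ((\<lambda>x. r *\<^sub>R sgn x) -` A \<inter> ?B)"
    using m by (simp add: sphere_measure_def emeasure_distr space_restrict_space)
  also have "emeasure (restrict_space lborel ?B) ((\<lambda>x. r *\<^sub>R sgn x) -` A \<inter> ?B) =
      emeasure lborel ((\<lambda>x. r *\<^sub>R sgn x) -` A \<inter> ?B)"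
    using B by (intro emeasure_restrict_space) auto
  also have "(\<lambda>x. r *\<^sub>R sgn x) -` A \<inter> ?B = {x \<in> ?B. r *\<^sub>R sgn x \<in> A}" by auto
  finally show ?thesis .
qed

section \<open>Spherical harmonics\<close>

text \<open>
  Functions on the unit sphere are represented by functions on the whole space that vanish
  off the sphere.
\<close>

definition homogeneous_harmonic_polynomial ::
  "nat \<Rightarrow> ('a::euclidean_space \<Rightarrow> complex) \<Rightarrow> bool" where
  "homogeneous_harmonic_polynomial l p \<longleftrightarrow>
     polynomial_function p \<and> (\<forall>c x. p (c *\<^sub>R x) = of_real (c ^ l) * p x) \<and>
     (\<forall>x. laplacian p x = 0)"

definition spherical_harmonics :: "nat \<Rightarrow> ('a::euclidean_space \<Rightarrow> complex) set" where
  "spherical_harmonics l =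
     {(\<lambda>x. if x \<in> sphere 0 1 then p x else 0) |p. homogeneous_harmonic_polynomial l p}"

interpretation cfun: vector_space "\<lambda>(c::complex) (f::'a \<Rightarrow> complex) x. c * f x"
  by unfold_locales (auto simp: fun_eq_iff algebra_simps)

definition harmonics_dim :: "'a::euclidean_space itself \<Rightarrow> nat \<Rightarrow> nat" where
  "harmonics_dim _ l = cfun.dim (spherical_harmonics l :: ('a \<Rightarrow> complex) set)"

definition spherical_harmonics_basis ::
  "(nat \<Rightarrow> nat \<Rightarrow> 'a::euclidean_space \<Rightarrow> complex) \<Rightarrow> bool" where
  "spherical_harmonics_basis Y \<longleftrightarrow>
     (\<forall>l. \<forall>m\<in>{1..harmonics_dim TYPE('a) l}. Y l m \<in> spherical_harmonics l) \<and>
     (\<forall>l. cfun.span (Y l ` {1..harmonics_dim TYPE('a) l}) = spherical_harmonics l) \<and>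
     (\<forall>l l'. \<forall>m\<in>{1..harmonics_dim TYPE('a) l}. \<forall>m'\<in>{1..harmonics_dim TYPE('a) l'}.
        (LINT x|sphere_measure 1. Y l m x * cnj (Y l' m' x)) =
        (if l = l' \<and> m = m' then 1 else 0))"

definition Fourier_Laplace_expansion ::
  "(nat \<Rightarrow> nat \<Rightarrow> 'a::euclidean_space \<Rightarrow> complex) \<Rightarrow> (nat \<Rightarrow> nat \<Rightarrow> complex) \<Rightarrow>
   ('a \<Rightarrow> complex) \<Rightarrow> bool" where
  "Fourier_Laplace_expansion Y \<alpha> f \<longleftrightarrow>
     f \<in> borel_measurable (sphere_measure 1) \<and>
     integrable (sphere_measure 1) (\<lambda>x. (cmod (f x))\<^sup>2) \<and>
     (\<lambda>L. LINT x|sphere_measure 1.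
        (cmod (f x - (\<Sum>l\<le>L. \<Sum>m=1..harmonics_dim TYPE('a) l. \<alpha> l m * Y l m x)))\<^sup>2)
     \<longlonglongrightarrow> 0"

section \<open>Steklov eigenvalues and the EMP matrix\<close>

text \<open>\<open>\<nu>\<close> is the outward unit normal field on the boundary of the domain.\<close>

definition Steklov_eigenfunction ::
  "'a::euclidean_space set \<Rightarrow> ('a \<Rightarrow> 'a) \<Rightarrow> real \<Rightarrow> ('a \<Rightarrow> complex) \<Rightarrow> bool" where
  "Steklov_eigenfunction \<Omega> \<nu> \<sigma> u \<longleftrightarrow>
     continuous_on (closure \<Omega>) u \<and> C_k_on 2 \<Omega> u \<and>
     (\<forall>x\<in>\<Omega>. laplacian u x = 0) \<and>
     (\<forall>x\<in>frontier \<Omega>. ((\<lambda>t. u (x + t *\<^sub>R \<nu> x)) has_vector_derivative of_real \<sigma> * u x)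
                       (at 0 within {..0})) \<and>
     (\<exists>x\<in>\<Omega>. u x \<noteq> 0)"

definition Steklov_eigenvalue ::
  "'a::euclidean_space set \<Rightarrow> ('a \<Rightarrow> 'a) \<Rightarrow> real \<Rightarrow> bool" where
  "Steklov_eigenvalue \<Omega> \<nu> \<sigma> \<longleftrightarrow> (\<exists>u. Steklov_eigenfunction \<Omega> \<nu> \<sigma> u)"

text \<open>
  The component along b of the tangential part of the gradient of u. The function u is complex
  valued and differentiable in a neighbourhood of the surface.
\<close>

definition tangential_gradient ::
  "('a::euclidean_space \<Rightarrow> 'a) \<Rightarrow> ('a \<Rightarrow> complex) \<Rightarrow> 'a \<Rightarrow> 'a \<Rightarrow> complex" where
  "tangential_gradient \<nu> u x b =
     partial_deriv b u x - of_real (b \<bullet> \<nu> x) * (\<Sum>c\<in>Basis. of_real (c \<bullet> \<nu> x) * partial_deriv c u x)"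

text \<open>
  \<open>S\<close>, \<open>\<nu>\<close> and \<open>H\<close> are the surface measure, the outward unit normal and the additive
  curvature of the boundary.
\<close>

definition EMP_matrix ::
  "'a::euclidean_space measure \<Rightarrow> ('a \<Rightarrow> 'a) \<Rightarrow> ('a \<Rightarrow> real) \<Rightarrow> ('a \<Rightarrow> 'a) \<Rightarrow> real \<Rightarrow>
   (nat \<Rightarrow> 'a \<Rightarrow> complex) \<Rightarrow> nat \<Rightarrow> nat \<Rightarrow> complex" where
  "EMP_matrix S \<nu> H V \<sigma> u i j =
     (LINT x|S.
        ((\<Sum>b\<in>Basis. tangential_gradient \<nu> (u i) x b * tangential_gradient \<nu> (\<lambda>y. cnj (u j y)) x b)
         - of_real (\<sigma>\<^sup>2 + \<sigma> * H x) * u i x * cnj (u j x)) * of_real (V x \<bullet> \<nu> x))"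

text \<open>For the centred ball of radius r, the outward unit normal at x is \<open>sgn x = x / norm x\<close>.\<close>

definition ball_EMP_matrix ::
  "real \<Rightarrow> ('a::euclidean_space \<Rightarrow> 'a) \<Rightarrow> real \<Rightarrow> (nat \<Rightarrow> 'a \<Rightarrow> complex) \<Rightarrow> nat \<Rightarrow> nat \<Rightarrow> complex" where
  "ball_EMP_matrix r V \<sigma> u =
     EMP_matrix (sphere_measure r) sgn (\<lambda>_. (real DIM('a) - 1) / r)
       (continuous_representative (ball 0 r) V) \<sigma> u"

definition ball_normal_component ::
  "real \<Rightarrow> ('a::euclidean_space \<Rightarrow> 'a) \<Rightarrow> 'a \<Rightarrow> real" where
  "ball_normal_component r V \<theta> = continuous_representative (ball 0 r) V (r *\<^sub>R \<theta>) \<bullet> \<theta>"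

text \<open>
  Only the values away from the origin are meaningful: since \<open>sgn 0 = 0\<close>, the value at the
  origin is 0 also for n = 0.
\<close>

definition ball_eigenfunction ::
  "(nat \<Rightarrow> nat \<Rightarrow> 'a::euclidean_space \<Rightarrow> complex) \<Rightarrow> real \<Rightarrow> nat \<Rightarrow> nat \<Rightarrow> 'a \<Rightarrow> complex" where
  "ball_eigenfunction Y r n i x =
     of_real (r powr (- (real DIM('a) - 1) / 2) * (norm x / r) ^ n) * Y n i (sgn x)"

definition EMP_coeff :: "nat \<Rightarrow> nat \<Rightarrow> nat \<Rightarrow> real \<Rightarrow> real" where
  "EMP_coeff d n l r = - (1 / r\<^sup>2) * (real l * (real l + real d - 2) / 2 + real n)"

end

theory Submission
  imports Defs
begin

text \<open>
  The eigenfunctions belonging to \<open>n / r\<^sub>o\<close> are, up to normalization, homogeneous harmonic polynomials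
  of degree n. Let p be the one with index i and q the conjugate of the one with index j. As p and q
  are harmonic, \<open>\<nabla>p \<bullet> \<nabla>q\<close> is half of the Laplacian of the product \<open>p q\<close>, and by Euler's identity the
  radial derivatives are n/r times the functions. The factor of the normal component of V in the
  integrand of the EMP matrix is therefore \<open>\<Delta>(p q) / 2\<close> minus a constant multiple of \<open>p q\<close>
  (\<open>tangential_gradient_product_harmonic\<close>).

  The product \<open>p q\<close> is homogeneous of degree 2n, and the Almansi decomposition
  (\<open>Almansi_decomposition\<close>) writes it as a sum of terms \<open>\<parallel>x\<parallel>\<^sup>2\<^sup>k h\<^sub>k\<close> with \<open>h\<^sub>k\<close> harmonic and
  homogeneous of degree \<open>l = 2n - 2k\<close>. On a sphere, the operator above multiplies each term by a
  number, which turns out to be \<open>EMP_coeff\<close> (\<open>EMP_integrand_on_sphere\<close>). This explains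
  why exactly the even degrees up to 2n occur.

  It remains to integrate the components \<open>h\<^sub>k\<close> against the normal component of V and to replace it by
  its Fourier-Laplace expansion. Spherical harmonics of different degrees are orthogonal for the
  bilinear product without conjugation (\<open>spherical_harmonics_orthogonal\<close>). Hence only the terms of
  degree l of the expansion meet \<open>h\<^sub>k\<close> (\<open>integral_mult_Fourier_Laplace_expansion\<close>), and for the same
  reason \<open>h\<^sub>k\<close> may be replaced by the full product \<open>Y\<^sub>n\<^sup>i cnj (Y\<^sub>n\<^sup>j)\<close> in the integral against a basis
  function of degree l.
\<close>

section \<open>Calculus of complex polynomial functions\<close>

lemma polynomial_function_complex_mult:
  fixes f g :: "'a::real_normed_vector \<Rightarrow> complex"
  assumes f: "polynomial_function f" and g: "polynomial_function g"
  shows "polynomial_function (\<lambda>x. f x * g x)"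
proof -
  have "polynomial_function (\<lambda>x. Re (f x))" "polynomial_function (\<lambda>x. Im (f x))"
    using f polynomial_function_bounded_linear bounded_linear_Re bounded_linear_Im
      polynomial_function_compose[of f Re] polynomial_function_compose[of f Im]
    by (auto simp: o_def)
  moreover have "polynomial_function (\<lambda>x. \<i> * g x)"
    using polynomial_function_compose[OF g, of "\<lambda>z. \<i> * z"] bounded_linear_mult_right[of \<i>]
    by (simp add: o_def polynomial_function_bounded_linear)
  ultimately have "polynomial_function (\<lambda>x. Re (f x) *\<^sub>R g x + Im (f x) *\<^sub>R (\<i> * g x))"
    using g by (intro polynomial_function_add polynomial_function_mult)
  moreover have "(\<lambda>x. Re (f x) *\<^sub>R g x + Im (f x) *\<^sub>R (\<i> * g x)) = (\<lambda>x. f x * g x)"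
    by (auto simp: fun_eq_iff complex_eq_iff algebra_simps)
  ultimately show ?thesis by simp
qed

lemma polynomial_function_of_real:
  assumes "polynomial_function f"
  shows "polynomial_function (\<lambda>x. complex_of_real (f x))"
  using polynomial_function_compose[OF assms
      polynomial_function_bounded_linear[OF bounded_linear_of_real]]
  by (simp add: o_def)

lemma polynomial_function_cnj:
  assumes "polynomial_function f"
  shows "polynomial_function (\<lambda>x. cnj (f x))"
  using polynomial_function_compose[OF assms, of cnj] bounded_linear_cnj
  by (auto simp: o_def polynomial_function_bounded_linear)

text \<open>
  The derivative is bundled as one function D of the point and the direction: for a fixed
  direction, the linear generators have a constant derivative, and the product rule stays within
  the polynomial functions of the point.
\<close>

lemma real_polynomial_function_derivative:
  fixes p :: "'a::real_normed_vector \<Rightarrow> real"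
  assumes "real_polynomial_function p"
  shows "\<exists>D. (\<forall>x. (p has_derivative D x) (at x)) \<and> (\<forall>b. real_polynomial_function (\<lambda>x. D x b))"
  using assms
proof induction
  case (linear f)
  then show ?case
    by (intro exI[of _ "\<lambda>x. f"]) (auto intro: bounded_linear_imp_has_derivative)
next
  case (const c)
  show ?case by (intro exI[of _ "\<lambda>x h. 0"]) auto
next
  case (add f g)
  then obtain D E where "\<And>x. (f has_derivative D x) (at x)" "\<And>b. real_polynomial_function (\<lambda>x. D x b)"
    "\<And>x. (g has_derivative E x) (at x)" "\<And>b. real_polynomial_function (\<lambda>x. E x b)" by blast
  then show ?case
    by (intro exI[of _ "\<lambda>x h. D x h + E x h"]) (auto intro: has_derivative_add)
next
  case (mult f g)
  then obtain D E where "\<And>x. (f has_derivative D x) (at x)" "\<And>b. real_polynomial_function (\<lambda>x. D x b)"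
    "\<And>x. (g has_derivative E x) (at x)" "\<And>b. real_polynomial_function (\<lambda>x. E x b)" by blast
  with mult.hyps show ?case
    by (intro exI[of _ "\<lambda>x h. f x * E x h + D x h * g x"]) (auto intro!: has_derivative_mult real_polynomial_function.intros(3,4))
qed

lemma polynomial_function_derivative:
  fixes p :: "'a::real_normed_vector \<Rightarrow> complex"
  assumes "polynomial_function p"
  shows "\<exists>D. (\<forall>x. (p has_derivative D x) (at x)) \<and> (\<forall>b. polynomial_function (\<lambda>x. D x b))"
proof -
  have "real_polynomial_function (\<lambda>x. Re (p x))" "real_polynomial_function (\<lambda>x. Im (p x))"
    using assms bounded_linear_Re bounded_linear_Im by (auto simp: polynomial_function_def o_def)
  from this[THEN real_polynomial_function_derivative] obtain D E
    where D: "\<And>x. ((\<lambda>x. Re (p x)) has_derivative D x) (at x)" "\<And>b. real_polynomial_function (\<lambda>x. D x b)"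
      and E: "\<And>x. ((\<lambda>x. Im (p x)) has_derivative E x) (at x)" "\<And>b. real_polynomial_function (\<lambda>x. E x b)"
    by auto
  define F where "F x h = complex_of_real (D x h) + complex_of_real (E x h) * \<i>" for x h
  have "(p has_derivative F x) (at x)" for x
  proof -
    have "((\<lambda>x. complex_of_real (Re (p x)) + complex_of_real (Im (p x)) * \<i>) has_derivative F x) (at x)"
      unfolding F_def
      by (intro has_derivative_add has_derivative_mult_left has_derivative_of_real D E)
    moreover have "(\<lambda>x. complex_of_real (Re (p x)) + complex_of_real (Im (p x)) * \<i>) = p"
      by (auto simp: complex_eq_iff)
    ultimately show ?thesis by simp
  qed
  moreover have "polynomial_function (\<lambda>x. F x b)" for b
    unfolding F_def using D(2) E(2)
    by (intro polynomial_function_add polynomial_function_complex_mult polynomial_function_of_real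
        polynomial_function_const) (auto simp: real_polynomial_function_eq)
  ultimately show ?thesis by blast
qed

lemma partial_deriv_eq: "(f has_derivative D) (at x) \<Longrightarrow> partial_deriv b f x = D b"
  unfolding partial_deriv_def by (metis frechet_derivative_at)

text \<open>
  This fact and the next one turn the total function \<open>partial_deriv\<close> into an operator on
  polynomial functions, so that partial derivatives can be iterated without discussing
  differentiability at each step.
\<close>

lemma polynomial_function_has_derivative:
  fixes p :: "'a::euclidean_space \<Rightarrow> complex"
  assumes "polynomial_function p"
  shows "(p has_derivative (\<lambda>b. partial_deriv b p x)) (at x)"
proof -
  obtain D where D: "(p has_derivative D) (at x)"
    using polynomial_function_derivative[OF assms] by blast
  then have "(\<lambda>b. partial_deriv b p x) = D" by (auto simp: partial_deriv_eq)
  with D show ?thesis by simp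
qed

lemma polynomial_function_partial_deriv:
  fixes p :: "'a::euclidean_space \<Rightarrow> complex"
  assumes "polynomial_function p"
  shows "polynomial_function (partial_deriv b p)"
proof -
  obtain D where "\<And>x. (p has_derivative D x) (at x)" "\<And>b. polynomial_function (\<lambda>x. D x b)"
    using polynomial_function_derivative[OF assms] by blast
  moreover from this have "partial_deriv b p = (\<lambda>x. D x b)" by (auto simp: partial_deriv_eq)
  ultimately show ?thesis by simp
qed

lemma partial_deriv_add:
  fixes p q :: "'a::euclidean_space \<Rightarrow> complex"
  assumes "polynomial_function p" "polynomial_function q"
  shows "partial_deriv b (\<lambda>x. p x + q x) = (\<lambda>x. partial_deriv b p x + partial_deriv b q x)"
  by (rule ext, rule partial_deriv_eq)
    (intro has_derivative_add polynomial_function_has_derivative assms)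

lemma partial_deriv_mult:
  fixes p q :: "'a::euclidean_space \<Rightarrow> complex"
  assumes "polynomial_function p" "polynomial_function q"
  shows "partial_deriv b (\<lambda>x. p x * q x) =
    (\<lambda>x. p x * partial_deriv b q x + partial_deriv b p x * q x)"
  by (rule ext, rule partial_deriv_eq)
    (intro has_derivative_mult polynomial_function_has_derivative assms)

lemma partial_deriv_const: "partial_deriv b (\<lambda>x. c) = (\<lambda>x. 0)"
  by (auto simp: partial_deriv_def)

lemma partial_deriv_cnj:
  fixes p :: "'a::euclidean_space \<Rightarrow> complex"
  assumes "polynomial_function p"
  shows "partial_deriv b (\<lambda>x. cnj (p x)) = (\<lambda>x. cnj (partial_deriv b p x))"
  by (rule ext, rule partial_deriv_eq)
    (intro has_derivative_cnj polynomial_function_has_derivative assms)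

lemma laplacian_eq: "laplacian p = (\<lambda>x. \<Sum>b\<in>Basis. partial_deriv b (partial_deriv b p) x)"
  by (simp add: laplacian_def fun_eq_iff)

lemma polynomial_function_laplacian:
  fixes p :: "'a::euclidean_space \<Rightarrow> complex"
  assumes "polynomial_function p"
  shows "polynomial_function (laplacian p)"
  unfolding laplacian_eq
  by (intro polynomial_function_sum polynomial_function_partial_deriv assms) auto

lemma laplacian_add:
  fixes p q :: "'a::euclidean_space \<Rightarrow> complex"
  assumes "polynomial_function p" "polynomial_function q"
  shows "laplacian (\<lambda>x. p x + q x) = (\<lambda>x. laplacian p x + laplacian q x)"
  using assms
  by (simp add: laplacian_eq partial_deriv_add polynomial_function_partial_deriv sum.distrib)

lemma laplacian_mult:
  fixes p q :: "'a::euclidean_space \<Rightarrow> complex"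
  assumes "polynomial_function p" "polynomial_function q"
  shows "laplacian (\<lambda>x. p x * q x) = (\<lambda>x. p x * laplacian q x + laplacian p x * q x +
    2 * (\<Sum>b\<in>Basis. partial_deriv b p x * partial_deriv b q x))"
  using assms
  by (simp add: laplacian_eq partial_deriv_mult partial_deriv_add polynomial_function_partial_deriv
      polynomial_function_complex_mult sum.distrib sum_distrib_left sum_distrib_right algebra_simps)

lemma laplacian_const: "laplacian (\<lambda>x::'a::euclidean_space. c::complex) = (\<lambda>x. 0)"
  by (simp add: laplacian_eq partial_deriv_const)

lemma laplacian_cmult:
  fixes p :: "'a::euclidean_space \<Rightarrow> complex"
  assumes "polynomial_function p"
  shows "laplacian (\<lambda>x. c * p x) = (\<lambda>x. c * laplacian p x)"
  using laplacian_mult[OF polynomial_function_const assms, of c]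
  by (simp add: laplacian_const partial_deriv_const)

lemma laplacian_sum:
  fixes p :: "'i \<Rightarrow> 'a::euclidean_space \<Rightarrow> complex"
  assumes "finite I" "\<And>i. i \<in> I \<Longrightarrow> polynomial_function (p i)"
  shows "laplacian (\<lambda>x. \<Sum>i\<in>I. p i x) = (\<lambda>x. \<Sum>i\<in>I. laplacian (p i) x)"
  using assms
  by (induction I rule: finite_induct)
    (auto simp: laplacian_const laplacian_add polynomial_function_sum)

lemma laplacian_cnj:
  fixes p :: "'a::euclidean_space \<Rightarrow> complex"
  assumes "polynomial_function p"
  shows "laplacian (\<lambda>x. cnj (p x)) = (\<lambda>x. cnj (laplacian p x))"
  using assms
  by (simp add: laplacian_eq partial_deriv_cnj polynomial_function_partial_deriv)

section \<open>Homogeneous polynomials and Euler's identity\<close>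

definition homogeneous_polynomial :: "nat \<Rightarrow> ('a::euclidean_space \<Rightarrow> complex) \<Rightarrow> bool" where
  "homogeneous_polynomial k p \<longleftrightarrow>
     polynomial_function p \<and> (\<forall>c x. p (c *\<^sub>R x) = of_real (c ^ k) * p x)"

lemma homogeneous_harmonic_polynomial_iff:
  "homogeneous_harmonic_polynomial l p \<longleftrightarrow> homogeneous_polynomial l p \<and> laplacian p = (\<lambda>x. 0)"
  by (auto simp: homogeneous_harmonic_polynomial_def homogeneous_polynomial_def)

text \<open>
  Because \<open>0 ^ 0 = 1\<close>, scaling by 0 shows that a homogeneous polynomial of degree 0 is constant.
\<close>

lemma homogeneous_polynomial_partial_deriv_0:
  assumes "homogeneous_polynomial 0 p"
  shows "partial_deriv b p = (\<lambda>x. 0)"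
proof -
  have "p (0 *\<^sub>R x) = of_real (0 ^ 0) * p x" for x
    using assms unfolding homogeneous_polynomial_def by blast
  then have "p = (\<lambda>x. p 0)" by (intro ext) (metis scaleR_zero_left power_0 of_real_1 mult_1)
  then show ?thesis by (metis partial_deriv_const)
qed

text \<open>
  Differentiating the identity that defines homogeneity with respect to x gives one factor c too
  many on both sides, which cancels for nonzero c.
\<close>

lemma homogeneous_polynomial_partial_deriv:
  fixes p :: "'a::euclidean_space \<Rightarrow> complex"
  assumes "homogeneous_polynomial (Suc k) p"
  shows "homogeneous_polynomial k (partial_deriv b p)"
proof -
  have p: "polynomial_function p" and hom: "\<And>c x. p (c *\<^sub>R x) = of_real (c ^ Suc k) * p x"
    using assms by (auto simp: homogeneous_polynomial_def)
  let ?q = "partial_deriv b p"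
  have q: "polynomial_function ?q" by (rule polynomial_function_partial_deriv[OF p])
  have nz: "?q (c *\<^sub>R x) = of_real (c ^ k) * ?q x" if "c \<noteq> 0" for c x
  proof -
    have "((\<lambda>x. p (c *\<^sub>R x)) has_derivative (\<lambda>b. partial_deriv (c *\<^sub>R b) p (c *\<^sub>R x))) (at x)"
      by (rule has_derivative_compose[where f = "\<lambda>x. c *\<^sub>R x"])
        (auto intro!: derivative_eq_intros polynomial_function_has_derivative p)
    moreover have "((\<lambda>x. p (c *\<^sub>R x)) has_derivative (\<lambda>b. of_real (c ^ Suc k) * partial_deriv b p x)) (at x)"
      unfolding hom by (intro has_derivative_mult_right polynomial_function_has_derivative p)
    ultimately have "partial_deriv (c *\<^sub>R b) p (c *\<^sub>R x) = of_real (c ^ Suc k) * ?q x"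
      using has_derivative_unique by metis
    moreover have "partial_deriv (c *\<^sub>R b) p (c *\<^sub>R x) = c *\<^sub>R ?q (c *\<^sub>R x)"
      by (rule linear_scale[OF has_derivative_linear[OF polynomial_function_has_derivative[OF p]]])
    ultimately have "of_real c * ?q (c *\<^sub>R x) = of_real c * (of_real (c ^ k) * ?q x)"
      by (simp add: scaleR_conv_of_real mult.assoc)
    with that show ?thesis by simp
  qed
  have "?q (c *\<^sub>R x) = of_real (c ^ k) * ?q x" for c x
  proof -
    \<comment> \<open>Both sides are continuous in the scaling factor, so the case of the factor 0 follows from
      the others.\<close>
    have "continuous_on UNIV (\<lambda>c. ?q (c *\<^sub>R x) - of_real (c ^ k) * ?q x)"
      by (intro continuous_intros continuous_on_compose2[OF continuous_on_polymonial_function[OF q]]) auto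
    then have cl: "closed {c. ?q (c *\<^sub>R x) - of_real (c ^ k) * ?q x = 0}"
      by (intro closed_Collect_eq) auto
    have "closure (UNIV - {0::real}) \<subseteq> {c. ?q (c *\<^sub>R x) - of_real (c ^ k) * ?q x = 0}"
      by (rule closure_minimal[OF _ cl]) (auto simp: nz)
    moreover have "closure (UNIV - {0::real}) = UNIV"
      by (metis Compl_eq_Diff_UNIV closure_complement interior_singleton double_complement Compl_empty_eq)
    ultimately show ?thesis by auto
  qed
  with q show ?thesis by (auto simp: homogeneous_polynomial_def)
qed

text \<open>
  Euler's identity is the derivative of the identity that defines homogeneity with respect to the
  scaling factor, taken at the factor 1.
\<close>

lemma Euler_homogeneous_polynomial:
  fixes p :: "'a::euclidean_space \<Rightarrow> complex"
  assumes "homogeneous_polynomial k p"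
  shows "(\<Sum>b\<in>Basis. of_real (b \<bullet> x) * partial_deriv b p x) = of_nat k * p x"
proof -
  have p: "polynomial_function p" and hom: "\<And>c x. p (c *\<^sub>R x) = of_real (c ^ k) * p x"
    using assms by (auto simp: homogeneous_polynomial_def)
  have "((\<lambda>t. p (t *\<^sub>R x)) has_derivative (\<lambda>t. partial_deriv (t *\<^sub>R x) p (1 *\<^sub>R x))) (at 1)"
    by (rule has_derivative_compose[where f = "\<lambda>t. t *\<^sub>R x"])
      (auto intro!: derivative_eq_intros polynomial_function_has_derivative p)
  moreover have "((\<lambda>t. p (t *\<^sub>R x)) has_derivative (\<lambda>t. of_real (t * of_nat k) * p x)) (at 1)"
    unfolding hom by (auto intro!: derivative_eq_intros)
  ultimately have "partial_deriv (1 *\<^sub>R x) p (1 *\<^sub>R x) = of_real (1 * of_nat k) * p x"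
    using has_derivative_unique by metis
  then have "partial_deriv x p x = of_nat k * p x" by simp
  moreover have lin: "linear (\<lambda>b. partial_deriv b p x)"
    using polynomial_function_has_derivative[OF p] by (blast intro: has_derivative_linear)
  have "partial_deriv (\<Sum>b\<in>Basis. (b \<bullet> x) *\<^sub>R b) p x = (\<Sum>b\<in>Basis. (b \<bullet> x) *\<^sub>R partial_deriv b p x)"
    unfolding linear_sum[OF lin] linear_scale[OF lin] ..
  moreover have "(\<Sum>b\<in>Basis. (b \<bullet> x) *\<^sub>R b) = x"
    by (metis (no_types, lifting) euclidean_representation inner_commute sum.cong)
  ultimately show ?thesis by (simp add: scaleR_conv_of_real)
qed

lemma homogeneous_polynomial_sum:
  assumes "finite I" "\<And>i. i \<in> I \<Longrightarrow> homogeneous_polynomial k (p i)"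
  shows "homogeneous_polynomial k (\<lambda>x. \<Sum>i\<in>I. p i x)"
  using assms by (auto simp: homogeneous_polynomial_def sum_distrib_left)

lemma homogeneous_polynomial_mult:
  assumes "homogeneous_polynomial k p" "homogeneous_polynomial l q"
  shows "homogeneous_polynomial (k + l) (\<lambda>x. p x * q x)"
  using assms by (auto simp: homogeneous_polynomial_def power_add polynomial_function_complex_mult)

lemma homogeneous_polynomial_cmult:
  assumes "homogeneous_polynomial k p"
  shows "homogeneous_polynomial k (\<lambda>x. c * p x)"
  using assms by (auto simp: homogeneous_polynomial_def polynomial_function_complex_mult)

lemma homogeneous_polynomial_diff:
  assumes "homogeneous_polynomial k p" "homogeneous_polynomial k q"
  shows "homogeneous_polynomial k (\<lambda>x. p x - q x)"
  using assms by (auto simp: homogeneous_polynomial_def algebra_simps)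

lemma homogeneous_polynomial_laplacian:
  fixes p :: "'a::euclidean_space \<Rightarrow> complex"
  assumes "homogeneous_polynomial (k + 2) p"
  shows "homogeneous_polynomial k (laplacian p)"
  unfolding laplacian_eq using assms
  by (intro homogeneous_polynomial_sum homogeneous_polynomial_partial_deriv) auto

lemma homogeneous_polynomial_laplacian_eq_0:
  fixes p :: "'a::euclidean_space \<Rightarrow> complex"
  assumes "homogeneous_polynomial k p" "k < 2"
  shows "laplacian p = (\<lambda>x. 0)"
proof (cases k)
  case 0
  with assms show ?thesis
    by (simp add: laplacian_eq homogeneous_polynomial_partial_deriv_0 partial_deriv_const)
next
  case (Suc k')
  with assms have "homogeneous_polynomial 0 (partial_deriv b p)" for b
    by (intro homogeneous_polynomial_partial_deriv) auto
  then show ?thesis by (simp add: laplacian_eq homogeneous_polynomial_partial_deriv_0)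
qed

section \<open>Almansi decomposition of homogeneous polynomials\<close>

abbreviation norm_sq :: "'a::euclidean_space \<Rightarrow> complex" where
  "norm_sq x \<equiv> complex_of_real (x \<bullet> x)"

lemma homogeneous_polynomial_norm_sq: "homogeneous_polynomial 2 (norm_sq :: 'a::euclidean_space \<Rightarrow> complex)"
proof -
  have "polynomial_function (\<lambda>x::'a. \<Sum>b\<in>Basis. (x \<bullet> b) *\<^sub>R (x \<bullet> b))"
    by (intro polynomial_function_sum polynomial_function_mult polynomial_function_bounded_linear
      bounded_linear_inner_left) auto
  moreover have "(\<lambda>x::'a. \<Sum>b\<in>Basis. (x \<bullet> b) *\<^sub>R (x \<bullet> b)) = (\<lambda>x. x \<bullet> x)"
    by (simp flip: euclidean_inner)
  ultimately have "polynomial_function (norm_sq :: 'a \<Rightarrow> complex)"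
    by (auto intro: polynomial_function_of_real)
  then show ?thesis by (simp add: homogeneous_polynomial_def power2_eq_square)
qed

lemma homogeneous_polynomial_norm_sq_power:
  "homogeneous_polynomial (2 * k) (\<lambda>x::'a::euclidean_space. norm_sq x ^ k)"
proof (induction k)
  case 0
  show ?case by (simp add: homogeneous_polynomial_def)
next
  case (Suc k)
  show ?case using homogeneous_polynomial_mult[OF homogeneous_polynomial_norm_sq Suc] by simp
qed

lemma partial_deriv_norm_sq: "partial_deriv b norm_sq = (\<lambda>x. complex_of_real (2 * (b \<bullet> x)))"
  by (rule ext, rule partial_deriv_eq)
    (auto intro!: derivative_eq_intros simp: inner_commute)

lemma laplacian_norm_sq:
  "laplacian (norm_sq :: 'a::euclidean_space \<Rightarrow> complex) = (\<lambda>x. 2 * of_nat DIM('a))"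
proof -
  have "partial_deriv b (\<lambda>x::'a. complex_of_real (2 * (b \<bullet> x))) x = of_real (2 * (b \<bullet> b))" for b x
    by (rule partial_deriv_eq, intro has_derivative_of_real has_derivative_mult_right
        has_derivative_inner_right has_derivative_ident)
  then show ?thesis
    by (simp add: laplacian_eq partial_deriv_norm_sq mult.commute)
qed

text \<open>
  The gradient of the squared norm at x is 2x, so Euler's identity evaluates the mixed term of the
  product rule for the Laplacian.
\<close>

lemma laplacian_norm_sq_mult:
  fixes g :: "'a::euclidean_space \<Rightarrow> complex"
  assumes "homogeneous_polynomial m g"
  shows "laplacian (\<lambda>x. norm_sq x * g x) =
    (\<lambda>x. of_nat (2 * (DIM('a) + 2 * m)) * g x + norm_sq x * laplacian g x)"
proof -
  have "(\<Sum>b\<in>Basis. of_real (2 * (b \<bullet> x)) * partial_deriv b g x) =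
      2 * (of_nat m * g x)" for x
    unfolding Euler_homogeneous_polynomial[OF assms, symmetric] sum_distrib_left
    by (simp add: mult.assoc)
  then show ?thesis
    using assms homogeneous_polynomial_norm_sq
    by (subst laplacian_mult)
      (auto simp: laplacian_norm_sq partial_deriv_norm_sq homogeneous_polynomial_def algebra_simps)
qed

text \<open>
  On products of a power of the squared norm and a fixed harmonic polynomial, the Laplacian only
  lowers the power, up to a positive factor. The positivity of the factor is what makes the
  decomposition below possible; its value determines the coefficients in the EMP matrix.
\<close>

lemma laplacian_norm_sq_power_mult_harmonic:
  fixes h :: "'a::euclidean_space \<Rightarrow> complex"
  assumes h: "homogeneous_harmonic_polynomial l h"
  shows "laplacian (\<lambda>x. norm_sq x ^ Suc k * h x) =
    (\<lambda>x. of_nat (2 * (k + 1) * (2 * k + 2 * l + DIM('a))) * (norm_sq x ^ k * h x))"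
proof (induction k)
  case 0
  show ?case
    using h laplacian_norm_sq_mult[of l h]
    by (simp add: homogeneous_harmonic_polynomial_iff fun_eq_iff algebra_simps)
next
  case (Suc k)
  have "homogeneous_polynomial (2 * Suc k + l) (\<lambda>x. norm_sq x ^ Suc k * h x)"
    using h by (intro homogeneous_polynomial_mult homogeneous_polynomial_norm_sq_power)
      (auto simp: homogeneous_harmonic_polynomial_iff)
  from laplacian_norm_sq_mult[OF this] Suc show ?case
    by (simp add: fun_eq_iff algebra_simps)
qed

lemma laplacian_iterate_norm_sq_power_mult_harmonic:
  fixes h :: "'a::euclidean_space \<Rightarrow> complex"
  assumes h: "homogeneous_harmonic_polynomial l h"
  shows "\<exists>C>0. \<forall>c. (laplacian ^^ k) (\<lambda>x. c * (norm_sq x ^ k * h x)) = (\<lambda>x. of_nat C * (c * h x))"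
proof (induction k)
  case 0
  show ?case by (intro exI[of _ 1]) auto
next
  case (Suc k)
  then obtain C where C: "C > 0"
    "\<And>c. (laplacian ^^ k) (\<lambda>x. c * (norm_sq x ^ k * h x)) = (\<lambda>x. of_nat C * (c * h x))" by blast
  define D where "D = 2 * (k + 1) * (2 * k + 2 * l + DIM('a))"
  have "homogeneous_polynomial (2 * Suc k + l) (\<lambda>x. norm_sq x ^ Suc k * h x)"
    using h by (intro homogeneous_polynomial_mult homogeneous_polynomial_norm_sq_power)
      (simp add: homogeneous_harmonic_polynomial_iff)
  then have p: "polynomial_function (\<lambda>x. norm_sq x ^ Suc k * h x)"
    unfolding homogeneous_polynomial_def by blast
  have "laplacian (\<lambda>x. c * (norm_sq x ^ Suc k * h x)) = (\<lambda>x. c * (of_nat D * (norm_sq x ^ k * h x)))" for c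
    unfolding laplacian_cmult[OF p] laplacian_norm_sq_power_mult_harmonic[OF h] D_def ..
  also have "\<dots> c = (\<lambda>x. (c * of_nat D) * (norm_sq x ^ k * h x))" for c
    by (simp only: mult.assoc)
  finally have "(laplacian ^^ Suc k) (\<lambda>x. c * (norm_sq x ^ Suc k * h x)) =
      (\<lambda>x. of_nat C * (c * of_nat D * h x))" for c
    unfolding funpow_Suc_right o_apply by (simp only: C(2))
  also have "\<dots> c = (\<lambda>x. of_nat (C * D) * (c * h x))" for c
    by (simp only: of_nat_mult mult_ac)
  finally have "(laplacian ^^ Suc k) (\<lambda>x. c * (norm_sq x ^ Suc k * h x)) =
      (\<lambda>x. of_nat (C * D) * (c * h x))" for c .
  moreover have "C * D > 0" using C(1) by (simp add: D_def)
  ultimately show ?case by blast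
qed

lemma laplacian_iterate_diff:
  fixes p q :: "'a::euclidean_space \<Rightarrow> complex"
  assumes "polynomial_function p" "polynomial_function q"
  shows "(laplacian ^^ k) (\<lambda>x. p x - q x) = (\<lambda>x. (laplacian ^^ k) p x - (laplacian ^^ k) q x)"
  using assms
proof (induction k arbitrary: p q)
  case (Suc k)
  have "laplacian (\<lambda>x. p x + (- 1) * q x) = (\<lambda>x. laplacian p x + (- 1) * laplacian q x)"
    using Suc.prems laplacian_cmult[of q "-1"]
    by (subst laplacian_add) (auto intro: polynomial_function_complex_mult)
  then show ?case
    using Suc.IH[of "laplacian p" "laplacian q"] Suc.prems
    unfolding funpow_Suc_right o_apply by (simp add: polynomial_function_laplacian)
qed auto

lemma homogeneous_polynomial_laplacian_iterate:
  fixes q :: "'a::euclidean_space \<Rightarrow> complex"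
  assumes "homogeneous_polynomial m q" "2 * k \<le> m"
  shows "homogeneous_polynomial (m - 2 * k) ((laplacian ^^ k) q)"
  using assms(2)
proof (induction k)
  case (Suc k)
  have "(m - 2 * Suc k) + 2 = m - 2 * k" using Suc.prems by simp
  moreover have "homogeneous_polynomial (m - 2 * k) ((laplacian ^^ k) q)"
    using Suc.IH Suc.prems by simp
  ultimately have "homogeneous_polynomial ((m - 2 * Suc k) + 2) ((laplacian ^^ k) q)" by (simp only:)
  then show ?case
    by (simp add: homogeneous_polynomial_laplacian)
qed (use assms in auto)

text \<open>
  Induction on the number of Laplacians that annihilate q. The polynomial that remains after all
  but one of them is harmonic, and a multiple of it times a power of the squared norm has the same
  image under these Laplacians, by the previous calculation. Subtracting this multiple from q
  leaves a polynomial that is annihilated one step earlier.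
\<close>

lemma Almansi_decomposition_aux:
  fixes q :: "'a::euclidean_space \<Rightarrow> complex"
  assumes "homogeneous_polynomial m q" "(laplacian ^^ K) q = (\<lambda>x. 0)" "2 * K \<le> m + 2"
  shows "\<exists>h. (\<forall>k<K. homogeneous_harmonic_polynomial (m - 2 * k) (h k)) \<and>
             (\<forall>x. q x = (\<Sum>k<K. norm_sq x ^ k * h k x))"
  using assms
proof (induction K arbitrary: q)
  case 0
  then show ?case by auto
next
  case (Suc K)
  define g where "g = (laplacian ^^ K) q"
  have g: "homogeneous_harmonic_polynomial (m - 2 * K) g"
    using Suc.prems homogeneous_polynomial_laplacian_iterate[of m q K]
    by (simp add: homogeneous_harmonic_polynomial_iff g_def)
  obtain C where C: "C > 0"
    "\<And>c. (laplacian ^^ K) (\<lambda>x. c * (norm_sq x ^ K * g x)) = (\<lambda>x. of_nat C * (c * g x))"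
    using laplacian_iterate_norm_sq_power_mult_harmonic[OF g] by blast
  define q' where "q' x = q x - inverse (of_nat C) * (norm_sq x ^ K * g x)" for x
  have "homogeneous_polynomial (2 * K + (m - 2 * K)) (\<lambda>x. norm_sq x ^ K * g x)"
    using g by (intro homogeneous_polynomial_mult homogeneous_polynomial_norm_sq_power)
      (auto simp: homogeneous_harmonic_polynomial_iff)
  then have gm: "homogeneous_polynomial m (\<lambda>x. inverse (of_nat C) * (norm_sq x ^ K * g x))"
    using Suc.prems by (auto intro: homogeneous_polynomial_cmult)
  have "(laplacian ^^ K) q' = (\<lambda>x. 0)"
    unfolding q'_def using gm Suc.prems C
    by (subst laplacian_iterate_diff) (auto simp: homogeneous_polynomial_def g_def)
  moreover have "homogeneous_polynomial m q'"
    unfolding q'_def by (intro homogeneous_polynomial_diff gm Suc.prems)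
  ultimately obtain h where h: "\<And>k. k < K \<Longrightarrow> homogeneous_harmonic_polynomial (m - 2 * k) (h k)"
    "\<And>x. q' x = (\<Sum>k<K. norm_sq x ^ k * h k x)"
    using Suc.IH[of q'] Suc.prems by auto
  define h' where "h' = h(K := (\<lambda>x. inverse (of_nat C) * g x))"
  have "homogeneous_harmonic_polynomial (m - 2 * K) (\<lambda>x. inverse (of_nat C) * g x)"
    using g laplacian_cmult[of g "inverse (of_nat C)"]
    by (auto simp: homogeneous_harmonic_polynomial_iff homogeneous_polynomial_def
      polynomial_function_complex_mult)
  then have "\<forall>k<Suc K. homogeneous_harmonic_polynomial (m - 2 * k) (h' k)"
    using h(1) by (auto simp: h'_def less_Suc_eq)
  moreover have "q x = (\<Sum>k<Suc K. norm_sq x ^ k * h' k x)" for x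
    using h(2)[of x] by (simp add: h'_def q'_def algebra_simps)
  ultimately show ?case by blast
qed

text \<open>
  Each Laplacian lowers the degree by two, so finitely many of them annihilate any homogeneous
  polynomial. On the unit sphere the powers of the squared norm are 1, and the decomposition is an
  expansion in spherical harmonics whose degrees have the same parity as m.
\<close>

lemma Almansi_decomposition:
  fixes q :: "'a::euclidean_space \<Rightarrow> complex"
  assumes q: "homogeneous_polynomial m q"
  obtains h where "\<And>k. k \<le> m div 2 \<Longrightarrow> homogeneous_harmonic_polynomial (m - 2 * k) (h k)"
    "\<And>x. q x = (\<Sum>k\<le>m div 2. norm_sq x ^ k * h k x)"
proof -
  have "homogeneous_polynomial (m - 2 * (m div 2)) ((laplacian ^^ (m div 2)) q)"
    by (rule homogeneous_polynomial_laplacian_iterate[OF q]) auto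
  then have "(laplacian ^^ Suc (m div 2)) q = (\<lambda>x. 0)"
    by (auto intro: homogeneous_polynomial_laplacian_eq_0)
  from Almansi_decomposition_aux[OF q this] that show ?thesis
    by (auto simp: lessThan_Suc_atMost less_Suc_eq_le)
qed

section \<open>Integration over spheres\<close>

lemma space_sphere_measure: "space (sphere_measure r :: 'a::euclidean_space measure) = sphere 0 r"
  by (simp add: sphere_measure_def space_scale_measure space_restrict_space)

lemma sets_sphere_measure [measurable_cong]:
  "sets (sphere_measure r) = sets (restrict_space borel (sphere (0::'a::euclidean_space) r))"
  by (simp add: sphere_measure_def)

lemma scale_measure_eq_density:
  "scale_measure c M = density M (\<lambda>_. c)"
  by (rule measure_eqI) (auto simp: emeasure_density_const)

lemma measurable_radial_projection:
  fixes S :: "'a::euclidean_space set"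
  assumes r: "r > 0" and S: "0 \<notin> S"
  shows "(\<lambda>x. r *\<^sub>R sgn x) \<in> restrict_space lborel S \<rightarrow>\<^sub>M restrict_space borel (sphere 0 r)"
proof -
  have "(\<lambda>x::'a. r *\<^sub>R sgn x) \<in> borel_measurable borel"
    unfolding sgn_div_norm by measurable
  with r S show ?thesis
    by (intro measurable_restrict_space2 measurable_restrict_space1)
      (auto simp: space_restrict_space norm_sgn)
qed

text \<open>
  The surface integral is a volume integral over the punctured ball of the extension of f that is
  constant along rays. Facts about the surface measure are thereby reduced to the Lebesgue measure.
\<close>

lemma integral_sphere_measure:
  fixes f :: "'a::euclidean_space \<Rightarrow> complex"
  assumes r: "r > 0" and f: "f \<in> borel_measurable (sphere_measure r)"
  shows "(LINT x|sphere_measure r. f x) =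
    (real DIM('a) / r) *\<^sub>R (LINT x|lborel. indicator (ball 0 r - {0}) x *\<^sub>R f (r *\<^sub>R sgn x))"
proof -
  let ?B = "ball 0 r - {0} :: 'a set"
  let ?N = "distr (restrict_space lborel ?B) (restrict_space borel (sphere 0 r)) (\<lambda>x. r *\<^sub>R sgn x)"
  have f': "f \<in> borel_measurable (restrict_space borel (sphere 0 r))"
    using f by (simp add: measurable_cong_sets[OF sets_sphere_measure refl])
  have "(LINT x|sphere_measure r. f x) = (LINT x|?N. (real DIM('a) / r) *\<^sub>R f x)"
    unfolding sphere_measure_def scale_measure_eq_density
    using r f' by (subst integral_density) auto
  also have "\<dots> = (real DIM('a) / r) *\<^sub>R (LINT x|?N. f x)" by simp
  also have "(LINT x|?N. f x) = (LINT x|restrict_space lborel ?B. f (r *\<^sub>R sgn x))"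
    by (rule integral_distr[OF measurable_radial_projection[OF r] f']) auto
  also have "\<dots> = (LINT x|lborel. indicator ?B x *\<^sub>R f (r *\<^sub>R sgn x))"
    by (rule integral_restrict_space) auto
  finally show ?thesis .
qed

lemma integral_lborel_scale:
  fixes f :: "'a::euclidean_space \<Rightarrow> complex"
  assumes r: "r > 0" and f: "f \<in> borel_measurable borel"
  shows "(LINT x|lborel. f x) = r ^ DIM('a) *\<^sub>R (LINT x|lborel. f (r *\<^sub>R x))"
proof -
  have "(LINT x|lborel. f x) =
      (LINT x|density (distr lborel borel (\<lambda>x::'a. 0 + r *\<^sub>R x)) (\<lambda>_. \<bar>r\<bar> ^ DIM('a)). f x)"
    using lborel_affine[of r "0::'a"] r by simp
  also have "\<dots> = r ^ DIM('a) *\<^sub>R (LINT x|lborel. f (r *\<^sub>R x))"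
    using r f by (subst integral_density) (auto simp: integral_distr)
  finally show ?thesis .
qed

text \<open>
  Dilating the cones over the sphere contributes \<open>r ^ DIM('a)\<close>, of which one factor cancels
  against the normalization of the surface measure.
\<close>

lemma integral_sphere_measure_scale:
  fixes f :: "'a::euclidean_space \<Rightarrow> complex"
  assumes r: "r > 0" and f: "f \<in> borel_measurable (sphere_measure r)"
  shows "(LINT x|sphere_measure r. f x) =
    of_real (r ^ (DIM('a) - 1)) * (LINT x|sphere_measure 1. f (r *\<^sub>R x))"
proof -
  let ?B = "\<lambda>r. ball 0 r - {0} :: 'a set"
  have f': "f \<in> borel_measurable (restrict_space borel (sphere 0 r))"
    using f by (simp add: measurable_cong_sets[OF sets_sphere_measure refl])
  have "(\<lambda>x. f (r *\<^sub>R sgn x)) \<in> borel_measurable (restrict_space lborel (?B r))"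
    by (rule measurable_compose[OF measurable_radial_projection[OF r] f']) auto
  then have m: "(\<lambda>x. indicator (?B r) x *\<^sub>R f (r *\<^sub>R sgn x)) \<in> borel_measurable borel"
    by (subst (asm) borel_measurable_restrict_space_iff) auto
  have "(\<lambda>x. r *\<^sub>R x) \<in> sphere_measure 1 \<rightarrow>\<^sub>M restrict_space borel (sphere (0::'a) r)"
    unfolding measurable_cong_sets[OF sets_sphere_measure refl] using r
    by (intro measurable_restrict_space2 measurable_restrict_space1) (auto simp: space_restrict_space)
  then have f1: "(\<lambda>x. f (r *\<^sub>R x)) \<in> borel_measurable (sphere_measure 1)"
    using f' by (rule measurable_compose)
  have "(LINT x|sphere_measure r. f x) = (real DIM('a) / r) *\<^sub>R r ^ DIM('a) *\<^sub>R
      (LINT x|lborel. indicator (?B r) (r *\<^sub>R x) *\<^sub>R f (r *\<^sub>R sgn (r *\<^sub>R x)))"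
    using integral_sphere_measure[OF r f] integral_lborel_scale[OF r m] by simp
  also have "(\<lambda>x. indicator (?B r) (r *\<^sub>R x) *\<^sub>R f (r *\<^sub>R sgn (r *\<^sub>R x))) =
      (\<lambda>x. indicator (?B 1) x *\<^sub>R f (r *\<^sub>R (1 *\<^sub>R sgn x)))"
    using r by (auto simp: fun_eq_iff indicator_def sgn_scaleR)
  also have "(real DIM('a) / r) *\<^sub>R r ^ DIM('a) *\<^sub>R (LINT x|lborel. \<dots> x) =
      r ^ (DIM('a) - 1) *\<^sub>R (LINT x|sphere_measure 1. f (r *\<^sub>R x))"
    unfolding integral_sphere_measure[OF zero_less_one f1] using r
    by (simp add: power_eq_if[of r "DIM('a)"])
  finally show ?thesis by (simp add: scaleR_conv_of_real)
qed

lemma finite_measure_sphere_measure: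
  assumes "r > 0"
  shows "finite_measure (sphere_measure r :: 'a::euclidean_space measure)"
proof
  let ?B = "ball 0 r - {0} :: 'a set"
  have "emeasure (sphere_measure r) (sphere 0 r :: 'a set) =
      ennreal (real DIM('a) / r) * emeasure lborel {x \<in> ?B. r *\<^sub>R sgn x \<in> sphere 0 r}"
    using assms by (intro emeasure_sphere_measure) auto
  also have "\<dots> \<le> ennreal (real DIM('a) / r) * emeasure lborel (ball (0::'a) r)"
    by (intro mult_left_mono emeasure_mono) auto
  also have "\<dots> < \<infinity>"
    using emeasure_lborel_ball_finite[of "0::'a" r] by (simp add: ennreal_mult_less_top)
  finally show "emeasure (sphere_measure r) (space (sphere_measure r :: 'a measure)) \<noteq> \<infinity>"
    by (simp add: space_sphere_measure)
qed

lemma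
  fixes f :: "'a::euclidean_space \<Rightarrow> complex"
  assumes r: "r > 0" and f: "continuous_on (sphere 0 r) f"
  shows borel_measurable_sphere_measure_continuous_on: "f \<in> borel_measurable (sphere_measure r)"
    and bounded_on_sphere_continuous_on: "\<exists>C. \<forall>x\<in>sphere 0 r. cmod (f x) \<le> C"
    and integrable_mult_continuous_on_sphere:
      "integrable (sphere_measure r) g \<Longrightarrow> integrable (sphere_measure r) (\<lambda>x. f x * g x :: complex)"
proof -
  show m: "f \<in> borel_measurable (sphere_measure r)"
    unfolding measurable_cong_sets[OF sets_sphere_measure refl]
    by (rule borel_measurable_continuous_on_restrict[OF f])
  have "bounded (f ` sphere 0 r)"
    by (intro compact_imp_bounded compact_continuous_image f) auto
  then show "\<exists>C. \<forall>x\<in>sphere 0 r. cmod (f x) \<le> C"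
    by (auto simp: bounded_iff)
  then obtain C where C: "\<And>x. x \<in> sphere 0 r \<Longrightarrow> cmod (f x) \<le> C" by blast
  assume g: "integrable (sphere_measure r) g"
  show "integrable (sphere_measure r) (\<lambda>x. f x * g x)"
  proof (rule Bochner_Integration.integrable_bound)
    show "integrable (sphere_measure r) (\<lambda>x. of_real C * g x)" using g by simp
    show "(\<lambda>x. f x * g x) \<in> borel_measurable (sphere_measure r)"
      using m borel_measurable_integrable[OF g] by simp
    show "AE x in sphere_measure r. norm (f x * g x) \<le> norm (of_real C * g x)"
    proof (rule AE_I2)
      fix x :: 'a
      assume "x \<in> space (sphere_measure r)"
      then have "cmod (f x) \<le> \<bar>C\<bar>" using C[of x] by (auto simp: space_sphere_measure)
      then show "norm (f x * g x) \<le> norm (of_real C * g x)"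
        by (simp add: norm_mult mult_right_mono)
    qed
  qed
qed

text \<open>
  Cauchy-Schwarz inequality with a constant function: the integral of the squared deviation of g
  from its mean is nonnegative.
\<close>

lemma (in finite_measure) integral_square_le:
  fixes g :: "'a \<Rightarrow> real"
  assumes g: "g \<in> borel_measurable M" and g2: "integrable M (\<lambda>x. (g x)\<^sup>2)"
  shows "integrable M g" "(LINT x|M. g x)\<^sup>2 \<le> measure M (space M) * (LINT x|M. (g x)\<^sup>2)"
proof -
  show int: "integrable M g"
  proof (rule Bochner_Integration.integrable_bound)
    show "integrable M (\<lambda>x. 1 + (g x)\<^sup>2)" using g2 by simp
    have "\<bar>t\<bar> \<le> 1 + t\<^sup>2" for t :: real
      using zero_le_power2[of "\<bar>t\<bar> - 1"] by (simp add: power2_diff)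
    then show "AE x in M. norm (g x) \<le> norm (1 + (g x)\<^sup>2)" by (auto simp: abs_of_nonneg add_nonneg_nonneg)
  qed (fact g)
  define \<mu> where "\<mu> = measure M (space M)"
  define I where "I = (LINT x|M. g x)"
  have "0 \<le> (LINT x|M. (\<mu> * g x - I)\<^sup>2)" by simp
  also have "\<dots> = (LINT x|M. \<mu>\<^sup>2 * (g x)\<^sup>2 - 2 * \<mu> * I * g x + I\<^sup>2)"
    by (intro Bochner_Integration.integral_cong) (auto simp: power2_eq_square algebra_simps)
  also have "\<dots> = \<mu>\<^sup>2 * (LINT x|M. (g x)\<^sup>2) - 2 * \<mu> * I * I + I\<^sup>2 * \<mu>"
    using int g2 by (simp add: I_def \<mu>_def)
  also have "\<dots> = \<mu> * (\<mu> * (LINT x|M. (g x)\<^sup>2) - I\<^sup>2)"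
    by (simp add: power2_eq_square algebra_simps)
  finally have *: "0 \<le> \<mu> * (\<mu> * (LINT x|M. (g x)\<^sup>2) - I\<^sup>2)" .
  show "I\<^sup>2 \<le> \<mu> * (LINT x|M. (g x)\<^sup>2)"
  proof (cases "\<mu> = 0")
    case True
    then have "AE x in M. g x = 0"
      by (intro AE_I[where N = "space M"]) (auto simp: \<mu>_def emeasure_eq_measure)
    then have "I = 0" unfolding I_def by (rule integral_eq_zero_AE)
    with True show ?thesis by simp
  next
    case False
    then have "\<mu> > 0" by (simp add: \<mu>_def less_le)
    with * show ?thesis by (simp add: zero_le_mult_iff)
  qed
qed

text \<open>
  By the preceding inequality, convergence in mean square implies convergence in mean, and this
  suffices for integrals against a bounded function.
\<close>

lemma (in finite_measure) tendsto_integral_mult_L2: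
  fixes f :: "'a \<Rightarrow> complex" and S :: "nat \<Rightarrow> 'a \<Rightarrow> complex"
  assumes f: "f \<in> borel_measurable M" "integrable M (\<lambda>x. (cmod (f x))\<^sup>2)"
    and S: "\<And>L. S L \<in> borel_measurable M" "\<And>L. \<exists>C. \<forall>x\<in>space M. cmod (S L x) \<le> C"
    and h: "h \<in> borel_measurable M" "\<And>x. x \<in> space M \<Longrightarrow> cmod (h x) \<le> B"
    and lim: "(\<lambda>L. LINT x|M. (cmod (f x - S L x))\<^sup>2) \<longlonglongrightarrow> 0"
  shows "(\<lambda>L. LINT x|M. h x * S L x) \<longlonglongrightarrow> (LINT x|M. h x * f x)"
proof -
  have int_bounded: "integrable M g" if "g \<in> borel_measurable M" "\<exists>C. \<forall>x\<in>space M. cmod (g x) \<le> C"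
    for g :: "'a \<Rightarrow> complex"
    using that integrable_const_bound[of g] by auto
  have h_int: "integrable M (\<lambda>x. h x * g x)" if "integrable M g" for g
  proof (rule Bochner_Integration.integrable_bound)
    show "integrable M (\<lambda>x. B *\<^sub>R g x)" using that by simp
    show "(\<lambda>x. h x * g x) \<in> borel_measurable M" using h borel_measurable_integrable[OF that] by simp
    have "cmod (h x) \<le> \<bar>B\<bar>" if "x \<in> space M" for x using h(2)[OF that] by linarith
    then show "AE x in M. norm (h x * g x) \<le> norm (B *\<^sub>R g x)"
      by (intro AE_I2) (simp add: norm_mult mult_right_mono)
  qed
  have "integrable M (\<lambda>x. cmod (f x))"
    by (rule integral_square_le(1)) (use f in simp_all)
  then have fi: "integrable M f" using f(1) by (simp add: integrable_norm_iff)
  have Si: "integrable M (S L)" for L by (intro int_bounded S)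
  have di: "integrable M (\<lambda>x. (cmod (f x - S L x))\<^sup>2)" for L
  proof -
    obtain C where C: "\<And>x. x \<in> space M \<Longrightarrow> cmod (S L x) \<le> C" using S(2) by blast
    show ?thesis
    proof (rule Bochner_Integration.integrable_bound)
      show "integrable M (\<lambda>x. 2 * (cmod (f x))\<^sup>2 + 2 * C\<^sup>2)" using f by simp
      show "AE x in M. norm ((cmod (f x - S L x))\<^sup>2) \<le> norm (2 * (cmod (f x))\<^sup>2 + 2 * C\<^sup>2)"
      proof (rule AE_I2)
        fix x assume x: "x \<in> space M"
        have "(cmod (f x - S L x))\<^sup>2 \<le> (cmod (f x) + C)\<^sup>2"
          using norm_triangle_ineq4[of "f x" "S L x"] C[OF x] by (intro power_mono) auto
        also have "\<dots> \<le> 2 * (cmod (f x))\<^sup>2 + 2 * C\<^sup>2"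
          using zero_le_power2[of "cmod (f x) - C"] by (simp add: power2_sum power2_diff)
        finally show "norm ((cmod (f x - S L x))\<^sup>2) \<le> norm (2 * (cmod (f x))\<^sup>2 + 2 * C\<^sup>2)" by simp
      qed
    qed (use f S in measurable)
  qed
  have *: "norm ((LINT x|M. h x * S L x) - (LINT x|M. h x * f x)) \<le>
      \<bar>B\<bar> * sqrt (measure M (space M) * (LINT x|M. (cmod (f x - S L x))\<^sup>2))" for L
  proof -
    have cm: "(\<lambda>x. cmod (f x - S L x)) \<in> borel_measurable M" using f S by measurable
    have "(LINT x|M. h x * S L x) - (LINT x|M. h x * f x) = (LINT x|M. h x * (S L x - f x))"
      using h_int[OF fi] h_int[OF Si] by (simp add: algebra_simps)
    also have "norm \<dots> \<le> (LINT x|M. \<bar>B\<bar> * cmod (f x - S L x))"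
    proof (rule order_trans[OF integral_norm_bound integral_mono])
      show "integrable M (\<lambda>x. norm (h x * (S L x - f x)))"
        by (intro integrable_norm h_int Bochner_Integration.integrable_diff fi Si)
      show "integrable M (\<lambda>x. \<bar>B\<bar> * cmod (f x - S L x))"
        using integral_square_le(1)[OF cm di] by simp
      fix x assume "x \<in> space M"
      from h(2)[OF this] have "cmod (h x) \<le> \<bar>B\<bar>" by linarith
      then show "norm (h x * (S L x - f x)) \<le> \<bar>B\<bar> * cmod (f x - S L x)"
        by (simp add: norm_mult norm_minus_commute mult_right_mono)
    qed
    also have "\<dots> = \<bar>B\<bar> * (LINT x|M. cmod (f x - S L x))" by simp
    also have "\<dots> \<le> \<bar>B\<bar> * sqrt (measure M (space M) * (LINT x|M. (cmod (f x - S L x))\<^sup>2))"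
      by (intro mult_left_mono real_le_rsqrt integral_square_le(2)[OF cm di]) auto
    finally show ?thesis .
  qed
  have "(\<lambda>L. \<bar>B\<bar> * sqrt (measure M (space M) * (LINT x|M. (cmod (f x - S L x))\<^sup>2)))
      \<longlonglongrightarrow> \<bar>B\<bar> * sqrt (measure M (space M) * 0)"
    by (intro tendsto_intros lim)
  then have "(\<lambda>L. (LINT x|M. h x * S L x) - (LINT x|M. h x * f x)) \<longlonglongrightarrow> 0"
    by (intro Lim_null_comparison[OF always_eventually[OF allI[OF *]]]) simp
  then show ?thesis by (simp add: LIM_zero_iff)
qed

lemma integral_sphere_measure_unscale:
  fixes g :: "'a::euclidean_space \<Rightarrow> complex"
  assumes r: "r > 0" and g: "g \<in> borel_measurable (sphere_measure 1)"
  shows "(LINT x|sphere_measure r. g (x /\<^sub>R r)) =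
    of_real (r ^ (DIM('a) - 1)) * (LINT x|sphere_measure 1. g x)"
proof -
  have "(\<lambda>x. x /\<^sub>R r) \<in> sphere_measure r \<rightarrow>\<^sub>M restrict_space borel (sphere (0::'a) 1)"
    unfolding measurable_cong_sets[OF sets_sphere_measure refl] using r
    by (intro measurable_restrict_space2 measurable_restrict_space1) (auto simp: space_restrict_space)
  moreover have "g \<in> borel_measurable (restrict_space borel (sphere 0 1))"
    using g by (simp add: measurable_cong_sets[OF sets_sphere_measure refl])
  ultimately have "(\<lambda>x. g (x /\<^sub>R r)) \<in> borel_measurable (sphere_measure r)"
    by (rule measurable_compose)
  from integral_sphere_measure_scale[OF r this] r show ?thesis by simp
qed

section \<open>Orthogonality of spherical harmonics and Fourier-Laplace coefficients\<close>

lemma spherical_harmonics_cnj: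
  assumes "f \<in> spherical_harmonics l"
  shows "(\<lambda>x. cnj (f x)) \<in> spherical_harmonics l"
proof -
  obtain p where p: "homogeneous_harmonic_polynomial l p" and f: "f = (\<lambda>x. if x \<in> sphere 0 1 then p x else 0)"
    using assms by (auto simp: spherical_harmonics_def)
  have "homogeneous_harmonic_polynomial l (\<lambda>x. cnj (p x))"
    using p by (auto simp: homogeneous_harmonic_polynomial_def laplacian_cnj polynomial_function_cnj)
  then show ?thesis
    unfolding spherical_harmonics_def f by (intro CollectI exI[of _ "\<lambda>x. cnj (p x)"]) auto
qed

lemma continuous_on_spherical_harmonics:
  assumes "f \<in> spherical_harmonics l"
  shows "continuous_on (sphere 0 1) f"
proof -
  obtain p where p: "homogeneous_harmonic_polynomial l p" and f: "f = (\<lambda>x. if x \<in> sphere 0 1 then p x else 0)"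
    using assms by (auto simp: spherical_harmonics_def)
  have "continuous_on (sphere 0 1) p"
    using p by (intro continuous_on_polymonial_function) (auto simp: homogeneous_harmonic_polynomial_def)
  then show ?thesis unfolding f by (rule continuous_on_eq) auto
qed

lemma integrable_sphere_measure_continuous_on:
  fixes f :: "'a::euclidean_space \<Rightarrow> complex"
  assumes r: "r > 0" and f: "continuous_on (sphere 0 r) f"
  shows "integrable (sphere_measure r) f"
proof -
  interpret finite_measure "sphere_measure r :: 'a measure"
    by (rule finite_measure_sphere_measure[OF r])
  show ?thesis
    using integrable_mult_continuous_on_sphere[OF r f, of "\<lambda>_. 1"] by simp
qed

text \<open>
  Continuity is included in the subspace because the integral is only additive on integrable
  functions; it has the value 0 on all others, and these are not closed under addition.
\<close>

lemma subspace_orthogonal_continuous: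
  fixes g :: "'a::euclidean_space \<Rightarrow> complex"
  assumes g: "continuous_on (sphere 0 1) g"
  shows "cfun.subspace {f. continuous_on (sphere 0 1) f \<and> (LINT x|sphere_measure 1. f x * g x) = 0}"
proof -
  have int: "integrable (sphere_measure 1) (\<lambda>x. f x * g x)" if "continuous_on (sphere 0 1) f" for f
    using that g by (intro integrable_sphere_measure_continuous_on continuous_intros) auto
  show ?thesis
    unfolding cfun.subspace_def
    by (auto intro: continuous_intros simp: zero_fun_def plus_fun_def distrib_right int mult.assoc)
qed

text \<open>
  Orthogonality need only be tested on the basis, which spans the spherical harmonics of degree l.
\<close>

lemma integral_mult_spherical_harmonics_eq_0:
  fixes Y :: "nat \<Rightarrow> nat \<Rightarrow> 'a::euclidean_space \<Rightarrow> complex"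
  assumes Y: "spherical_harmonics_basis Y" and g: "continuous_on (sphere 0 1) g"
    and 0: "\<And>m. m \<in> {1..harmonics_dim TYPE('a) l} \<Longrightarrow> (LINT x|sphere_measure 1. Y l m x * g x) = 0"
    and f: "f \<in> spherical_harmonics l"
  shows "(LINT x|sphere_measure 1. f x * g x) = 0"
proof -
  let ?T = "{f. continuous_on (sphere 0 1) f \<and> (LINT x|sphere_measure 1. f x * g x) = 0}"
  have "Y l ` {1..harmonics_dim TYPE('a) l} \<subseteq> ?T"
    using Y 0 by (auto simp: spherical_harmonics_basis_def intro: continuous_on_spherical_harmonics)
  then have "cfun.span (Y l ` {1..harmonics_dim TYPE('a) l}) \<subseteq> ?T"
    by (rule cfun.span_minimal[OF _ subspace_orthogonal_continuous[OF g]])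
  with Y f show ?thesis by (auto simp: spherical_harmonics_basis_def)
qed

text \<open>
  The given basis is orthonormal for the Hermitian product, so harmonics of different degrees are
  orthogonal for it. As each space of spherical harmonics is closed under complex conjugation, the
  same holds for the bilinear product, which is the one that occurs in the integrals of three
  harmonics.
\<close>

lemma spherical_harmonics_orthogonal:
  fixes Y :: "nat \<Rightarrow> nat \<Rightarrow> 'a::euclidean_space \<Rightarrow> complex" and f g :: "'a \<Rightarrow> complex"
  assumes Y: "spherical_harmonics_basis Y" and ne: "l \<noteq> l'"
    and f: "f \<in> spherical_harmonics l" and g: "g \<in> spherical_harmonics l'"
  shows "(LINT x|sphere_measure 1. f x * g x) = 0"
proof -
  have cont: "continuous_on (sphere 0 1) (\<lambda>x. cnj (f x))" if "f \<in> spherical_harmonics k" for f :: "'a \<Rightarrow> complex" and k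
    using that by (intro continuous_on_spherical_harmonics[OF spherical_harmonics_cnj])
  have YY: "(LINT x|sphere_measure 1. Y l m x * cnj (Y l' m' x)) = 0"
    if "m \<in> {1..harmonics_dim TYPE('a) l}" "m' \<in> {1..harmonics_dim TYPE('a) l'}" for m m'
    using Y that ne unfolding spherical_harmonics_basis_def by simp
  have Yin: "Y l' m' \<in> spherical_harmonics l'" if "m' \<in> {1..harmonics_dim TYPE('a) l'}" for m'
    using Y that unfolding spherical_harmonics_basis_def by simp
  have fY: "(LINT x|sphere_measure 1. Y l' m' x * f x) = 0"
    if m': "m' \<in> {1..harmonics_dim TYPE('a) l'}" for m'
  proof -
    have "(LINT x|sphere_measure 1. cnj (f x) * cnj (Y l' m' x)) = 0"
      by (rule integral_mult_spherical_harmonics_eq_0[OF Y cont[OF Yin[OF m']]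
            YY[OF _ m'] spherical_harmonics_cnj[OF f]])
    then have "(LINT x|sphere_measure 1. cnj (Y l' m' x * f x)) = 0"
      by (simp add: mult.commute)
    then show ?thesis by (simp only: Bochner_Integration.integral_cnj complex_cnj_zero_iff)
  qed
  have "(LINT x|sphere_measure 1. g x * f x) = 0"
    by (rule integral_mult_spherical_harmonics_eq_0[OF Y continuous_on_spherical_harmonics[OF f] fY g])
  then show ?thesis by (simp add: mult.commute)
qed

text \<open>
  The integral of h against a partial sum of the expansion does not change any more once the
  partial sum includes degree l, because h is orthogonal to all other degrees. The partial sums
  converge in mean square, hence this constant is the integral of h against v.
\<close>

lemma integral_mult_Fourier_Laplace_expansion:
  fixes Y :: "nat \<Rightarrow> nat \<Rightarrow> 'a::euclidean_space \<Rightarrow> complex"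
  assumes Y: "spherical_harmonics_basis Y" and v: "Fourier_Laplace_expansion Y \<alpha> v"
    and h: "h \<in> spherical_harmonics l"
  shows "(LINT x|sphere_measure 1. h x * v x) =
    (\<Sum>m=1..harmonics_dim TYPE('a) l. \<alpha> l m * (LINT x|sphere_measure 1. h x * Y l m x))"
    (is "_ = ?R")
proof -
  interpret finite_measure "sphere_measure 1 :: 'a measure"
    by (rule finite_measure_sphere_measure) simp
  define S where "S L x = (\<Sum>l\<le>L. \<Sum>m=1..harmonics_dim TYPE('a) l. \<alpha> l m * Y l m x)" for L x
  have Yin: "Y l m \<in> spherical_harmonics l" if "m \<in> {1..harmonics_dim TYPE('a) l}" for l m
    using Y that by (simp add: spherical_harmonics_basis_def)
  note Yc = continuous_on_spherical_harmonics[OF Yin]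
  have Sc: "continuous_on (sphere 0 1) (S L)" for L
    unfolding S_def by (intro continuous_intros Yc)
  note hc = continuous_on_spherical_harmonics[OF h]
  obtain B where B: "\<And>x. x \<in> sphere 0 1 \<Longrightarrow> cmod (h x) \<le> B"
    using bounded_on_sphere_continuous_on[OF zero_less_one hc] by blast
  have "(\<lambda>L. LINT x|sphere_measure 1. h x * S L x) \<longlonglongrightarrow> (LINT x|sphere_measure 1. h x * v x)"
  proof (rule tendsto_integral_mult_L2)
    show "v \<in> borel_measurable (sphere_measure 1)" "integrable (sphere_measure 1) (\<lambda>x. (cmod (v x))\<^sup>2)"
      "(\<lambda>L. LINT x|sphere_measure 1. (cmod (v x - S L x))\<^sup>2) \<longlonglongrightarrow> 0"
      using v by (auto simp: Fourier_Laplace_expansion_def S_def)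
    show "S L \<in> borel_measurable (sphere_measure 1)" for L
      by (rule borel_measurable_sphere_measure_continuous_on[OF zero_less_one Sc])
    show "\<exists>C. \<forall>x\<in>space (sphere_measure 1). cmod (S L x) \<le> C" for L
      unfolding space_sphere_measure by (rule bounded_on_sphere_continuous_on[OF zero_less_one Sc])
    show "h \<in> borel_measurable (sphere_measure 1)"
      by (rule borel_measurable_sphere_measure_continuous_on[OF zero_less_one hc])
    show "cmod (h x) \<le> B" if "x \<in> space (sphere_measure 1)" for x
      using that B by (simp add: space_sphere_measure)
  qed
  moreover have "(LINT x|sphere_measure 1. h x * S L x) = ?R" if "l \<le> L" for L
  proof -
    have int: "integrable (sphere_measure 1) (\<lambda>x. \<alpha> l' m * (h x * Y l' m x))"
      if "m \<in> {1..harmonics_dim TYPE('a) l'}" for l' m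
      using that
      by (intro integrable_sphere_measure_continuous_on continuous_intros hc Yc) auto
    have "(LINT x|sphere_measure 1. h x * S L x) = (LINT x|sphere_measure 1.
        (\<Sum>l'\<le>L. \<Sum>m=1..harmonics_dim TYPE('a) l'. \<alpha> l' m * (h x * Y l' m x)))"
      by (simp add: S_def sum_distrib_left mult_ac)
    also have "\<dots> = (\<Sum>l'\<le>L. \<Sum>m=1..harmonics_dim TYPE('a) l'.
        (LINT x|sphere_measure 1. \<alpha> l' m * (h x * Y l' m x)))"
    proof (subst Bochner_Integration.integral_sum)
      show "integrable (sphere_measure 1)
          (\<lambda>x. \<Sum>m=1..harmonics_dim TYPE('a) l'. \<alpha> l' m * (h x * Y l' m x))" for l'
        by (intro Bochner_Integration.integrable_sum int)
    qed (intro sum.cong refl Bochner_Integration.integral_sum int)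
    also have "\<dots> = (\<Sum>l'\<le>L. if l' = l then ?R else 0)"
      using spherical_harmonics_orthogonal[OF Y _ h Yin]
      by (intro sum.cong refl) (auto intro!: sum.neutral)
    also have "\<dots> = ?R" using that by simp
    finally show ?thesis .
  qed
  then have "(\<lambda>L. LINT x|sphere_measure 1. h x * S L x) \<longlonglongrightarrow> ?R"
    by (intro tendsto_eventually) (auto simp: eventually_at_top_linorder)
  ultimately show ?thesis by (rule LIMSEQ_unique)
qed

section \<open>The integrand of the EMP matrix on a sphere\<close>

text \<open>
  The Steklov eigenfunctions of the ball are written in polar coordinates. They are multiples of
  harmonic polynomials except possibly at the origin, which is enough to identify their derivatives on
  spheres.
\<close>

lemma partial_deriv_cong_off_origin:
  fixes u p :: "'a::euclidean_space \<Rightarrow> complex"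
  assumes "\<And>y. y \<noteq> 0 \<Longrightarrow> u y = c * p y" "polynomial_function p" "x \<noteq> 0"
  shows "partial_deriv b u x = c * partial_deriv b p x"
proof (rule partial_deriv_eq)
  have "((\<lambda>x. c * p x) has_derivative (\<lambda>b. c * partial_deriv b p x)) (at x)"
    by (intro has_derivative_mult_right polynomial_function_has_derivative assms)
  then show "(u has_derivative (\<lambda>b. c * partial_deriv b p x)) (at x)"
    by (rule has_derivative_transform_within_open[where s = "- {0}"]) (use assms in auto)
qed

lemma tangential_gradient_cong_off_origin:
  fixes u p :: "'a::euclidean_space \<Rightarrow> complex"
  assumes "\<And>y. y \<noteq> 0 \<Longrightarrow> u y = c * p y" "polynomial_function p" "x \<noteq> 0"
  shows "tangential_gradient \<nu> u x b = c * tangential_gradient \<nu> p x b"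
proof -
  have "partial_deriv b u x = c * partial_deriv b p x" for b
    by (rule partial_deriv_cong_off_origin[OF assms])
  then show ?thesis
    by (simp add: tangential_gradient_def sum_distrib_left algebra_simps)
qed

text \<open>
  By Euler's identity, the radial derivative of a homogeneous polynomial is a multiple of the
  polynomial.
\<close>

lemma tangential_gradient_sgn_homogeneous_polynomial:
  fixes p :: "'a::euclidean_space \<Rightarrow> complex"
  assumes "homogeneous_polynomial k p"
  shows "tangential_gradient sgn p x b =
    partial_deriv b p x - of_real (b \<bullet> x) * (of_nat k / of_real ((norm x)\<^sup>2) * p x)"
proof -
  have "(\<Sum>c\<in>Basis. complex_of_real (c \<bullet> sgn x) * partial_deriv c p x) =
      inverse (of_real (norm x)) * (\<Sum>c\<in>Basis. of_real (c \<bullet> x) * partial_deriv c p x)"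
    by (simp add: sgn_div_norm sum_distrib_left mult.assoc)
  also have "\<dots> = inverse (of_real (norm x)) * (of_nat k * p x)"
    by (simp add: Euler_homogeneous_polynomial[OF assms])
  finally show ?thesis
    unfolding tangential_gradient_def by (simp add: sgn_div_norm power2_eq_square field_simps)
qed

text \<open>
  For harmonic p and q, the product rule turns the product of the full gradients into half of the
  Laplacian of \<open>p q\<close>. The radial parts contribute the product of the two radial derivatives, by
  Euler's identity.
\<close>

lemma tangential_gradient_product_harmonic:
  fixes p q :: "'a::euclidean_space \<Rightarrow> complex"
  assumes p: "homogeneous_harmonic_polynomial k p" and q: "homogeneous_harmonic_polynomial l q"
    and x: "x \<noteq> 0"
  shows "(\<Sum>b\<in>Basis. tangential_gradient sgn p x b * tangential_gradient sgn q x b) =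
    laplacian (\<lambda>x. p x * q x) x / 2 - of_nat (k * l) / of_real ((norm x)\<^sup>2) * (p x * q x)"
proof -
  have p': "homogeneous_polynomial k p" "polynomial_function p" "laplacian p = (\<lambda>x. 0)"
    and q': "homogeneous_polynomial l q" "polynomial_function q" "laplacian q = (\<lambda>x. 0)"
    using p q by (auto simp: homogeneous_harmonic_polynomial_iff homogeneous_polynomial_def)
  define P where "P = of_nat k / complex_of_real ((norm x)\<^sup>2) * p x"
  define Q where "Q = of_nat l / complex_of_real ((norm x)\<^sup>2) * q x"
  define G where "G = (\<Sum>b\<in>Basis. partial_deriv b p x * partial_deriv b q x)"
  have lap: "laplacian (\<lambda>x. p x * q x) x = 2 * G"
    using laplacian_mult[OF p'(2) q'(2)] p' q' by (simp add: G_def)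
  have "(\<Sum>b\<in>Basis. tangential_gradient sgn p x b * tangential_gradient sgn q x b) =
      (\<Sum>b\<in>Basis. partial_deriv b p x * partial_deriv b q x
        - Q * (of_real (b \<bullet> x) * partial_deriv b p x) - P * (of_real (b \<bullet> x) * partial_deriv b q x)
        + P * Q * of_real ((b \<bullet> x) * (b \<bullet> x)))"
    unfolding tangential_gradient_sgn_homogeneous_polynomial[OF p'(1)]
      tangential_gradient_sgn_homogeneous_polynomial[OF q'(1)] P_def[symmetric] Q_def[symmetric]
    by (intro sum.cong refl) (simp add: algebra_simps)
  also have "\<dots> = G - Q * (of_nat k * p x) - P * (of_nat l * q x)
      + P * Q * of_real (\<Sum>b\<in>Basis. (b \<bullet> x) * (b \<bullet> x))"
    unfolding sum.distrib sum_subtractf sum_distrib_left[symmetric] of_real_sum[symmetric]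
      Euler_homogeneous_polynomial[OF p'(1)] Euler_homogeneous_polynomial[OF q'(1)] G_def ..
  also have "(\<Sum>b\<in>Basis. (b \<bullet> x) * (b \<bullet> x)) = (norm x)\<^sup>2"
    unfolding power2_norm_eq_inner euclidean_inner[of x x] by (simp add: inner_commute)
  also have "P * Q * complex_of_real ((norm x)\<^sup>2) = P * (of_nat l * q x)"
    using x by (simp add: Q_def)
  also have "Q * (of_nat k * p x) = of_nat (k * l) / of_real ((norm x)\<^sup>2) * (p x * q x)"
    by (simp add: Q_def)
  finally show ?thesis by (simp add: lap)
qed

text \<open>
  Multiplying by the squared norm restores the power, so that these functions behave like
  eigenfunctions of the Laplacian on a fixed sphere.
\<close>

lemma norm_sq_mult_laplacian_norm_sq_power_mult_harmonic:
  fixes h :: "'a::euclidean_space \<Rightarrow> complex"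
  assumes h: "homogeneous_harmonic_polynomial l h"
  shows "norm_sq x * laplacian (\<lambda>x. norm_sq x ^ k * h x) x =
    of_real (2 * real k * (2 * real k + 2 * real l + real DIM('a) - 2)) * (norm_sq x ^ k * h x)"
proof (cases k)
  case 0
  then show ?thesis using h by (simp add: homogeneous_harmonic_polynomial_iff)
next
  case (Suc k')
  then show ?thesis
    using laplacian_norm_sq_power_mult_harmonic[OF h, of k'] by (simp add: algebra_simps)
qed

text \<open>
  By the previous lemmas the left-hand side depends on \<open>p q\<close> linearly, through \<open>p q\<close> and its
  Laplacian, so it can be evaluated on each term of the Almansi decomposition of \<open>p q\<close>. With
  \<open>l = 2 n - 2 k\<close>, the half of the Laplacian contributes
  \<open>2 n\<^sup>2 + n (d - 2) - l (l + d - 2) / 2\<close> times \<open>1 / r\<^sup>2\<close>; the radial gradients contribute \<open>- n\<^sup>2\<close>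
  and the term with the eigenvalue and the curvature \<open>- n\<^sup>2 - n (d - 1)\<close>, over the same \<open>r\<^sup>2\<close>.
  What remains is \<open>- l (l + d - 2) / 2 - n\<close>.
\<close>

lemma EMP_integrand_on_sphere:
  fixes p q :: "'a::euclidean_space \<Rightarrow> complex"
  assumes p: "homogeneous_harmonic_polynomial n p" and q: "homogeneous_harmonic_polynomial n q"
    and h: "\<And>k. k \<le> n \<Longrightarrow> homogeneous_harmonic_polynomial (2 * n - 2 * k) (h k)"
    and pq: "\<And>x. p x * q x = (\<Sum>k\<le>n. norm_sq x ^ k * h k x)"
    and r: "r > 0" and x: "norm x = r"
  shows "(\<Sum>b\<in>Basis. tangential_gradient sgn p x b * tangential_gradient sgn q x b)
      - of_real ((real n / r)\<^sup>2 + real n / r * ((real DIM('a) - 1) / r)) * (p x * q x) =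
    of_real (r ^ (2 * n)) * (\<Sum>k\<le>n. of_real (EMP_coeff DIM('a) n (2 * n - 2 * k) r) * h k (x /\<^sub>R r))"
proof -
  have sx: "norm_sq x = of_real (r\<^sup>2)" using x by (simp add: power2_norm_eq_inner[symmetric])
  have hk: "norm_sq x ^ k * h k x = of_real (r ^ (2 * n)) * h k (x /\<^sub>R r)" if k: "k \<le> n" for k
  proof -
    have "h k x = h k (r *\<^sub>R (x /\<^sub>R r))" using r by simp
    also have "\<dots> = of_real (r ^ (2 * n - 2 * k)) * h k (x /\<^sub>R r)"
      using h[OF k] unfolding homogeneous_harmonic_polynomial_def by blast
    finally have "norm_sq x ^ k * h k x = of_real (r ^ (2 * k) * r ^ (2 * n - 2 * k)) * h k (x /\<^sub>R r)"
      by (simp add: sx power_mult)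
    also have "r ^ (2 * k) * r ^ (2 * n - 2 * k) = r ^ (2 * n)"
      using k by (simp flip: power_add)
    finally show ?thesis .
  qed
  have poly: "polynomial_function (\<lambda>x. norm_sq x ^ k * h k x)" if "k \<le> n" for k
    using homogeneous_polynomial_mult[OF homogeneous_polynomial_norm_sq_power[of k], of _ "h k"] h[OF that]
    unfolding homogeneous_harmonic_polynomial_iff homogeneous_polynomial_def by blast
  have "norm_sq x * laplacian (\<lambda>x. p x * q x) x =
      (\<Sum>k\<le>n. norm_sq x * laplacian (\<lambda>x. norm_sq x ^ k * h k x) x)"
    unfolding pq by (subst laplacian_sum[OF finite_atMost poly]) (auto simp: sum_distrib_left)
  also have "\<dots> = (\<Sum>k\<le>n. of_real (2 * real k * (2 * real k + 2 * real (2 * n - 2 * k) + real DIM('a) - 2))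
      * (norm_sq x ^ k * h k x))"
    by (intro sum.cong refl norm_sq_mult_laplacian_norm_sq_power_mult_harmonic h) auto
  finally have lap: "laplacian (\<lambda>x. p x * q x) x = (\<Sum>k\<le>n. of_real (2 * real k *
      (2 * real k + 2 * real (2 * n - 2 * k) + real DIM('a) - 2)) * (norm_sq x ^ k * h k x)) / of_real (r\<^sup>2)"
    using r by (simp add: sx field_simps)
  have "x \<noteq> 0" using r x by auto
  define e where "e = (real n / r)\<^sup>2 + real n / r * ((real DIM('a) - 1) / r)"
  define a where "a k = 2 * real k * (2 * real k + 2 * real (2 * n - 2 * k) + real DIM('a) - 2)" for k
  define T where "T k = norm_sq x ^ k * h k x" for k
  have "(\<Sum>b\<in>Basis. tangential_gradient sgn p x b * tangential_gradient sgn q x b)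
      - of_real e * (p x * q x) =
    (\<Sum>k\<le>n. of_real (a k) * T k) / of_real (r\<^sup>2) / 2
      - of_nat (n * n) / of_real (r\<^sup>2) * (\<Sum>k\<le>n. T k) - of_real e * (\<Sum>k\<le>n. T k)"
    unfolding tangential_gradient_product_harmonic[OF p q \<open>x \<noteq> 0\<close>] lap pq[of x] x a_def T_def ..
  also have "\<dots> = (\<Sum>k\<le>n. of_real (a k) * T k / of_real (r\<^sup>2) / 2
      - of_nat (n * n) / of_real (r\<^sup>2) * T k - of_real e * T k)"
    by (simp only: sum_divide_distrib sum_distrib_left sum_subtractf)
  also have "\<dots> = (\<Sum>k\<le>n. of_real (a k / (2 * r\<^sup>2) - real (n * n) / r\<^sup>2 - e) * T k)"
    by (intro sum.cong refl) (simp add: algebra_simps)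
  also have "\<dots> = (\<Sum>k\<le>n. of_real (EMP_coeff DIM('a) n (2 * n - 2 * k) r) * T k)"
  proof (intro sum.cong refl arg_cong2[where f = "(*)"] arg_cong[where f = of_real])
    fix k assume "k \<in> {..n}"
    then have *: "real (2 * n - 2 * k) = 2 * real n - 2 * real k" by simp
    show "a k / (2 * r\<^sup>2) - real (n * n) / r\<^sup>2 - e = EMP_coeff DIM('a) n (2 * n - 2 * k) r"
      unfolding EMP_coeff_def a_def e_def * using r by (simp add: field_simps power2_eq_square)
  qed
  also have "\<dots> = of_real (r ^ (2 * n)) *
      (\<Sum>k\<le>n. of_real (EMP_coeff DIM('a) n (2 * n - 2 * k) r) * h k (x /\<^sub>R r))"
    unfolding sum_distrib_left T_def
    by (intro sum.cong refl, subst hk) simp_all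
  finally show ?thesis unfolding e_def .
qed

lemma ball_eigenfunction_eq_polynomial:
  assumes r: "r > 0" and y: "y \<noteq> 0" and p: "homogeneous_harmonic_polynomial n p"
    and Y: "Y n i = (\<lambda>x::'a::euclidean_space. if x \<in> sphere 0 1 then p x else 0)"
  shows "ball_eigenfunction Y r n i y = of_real (r powr (- (real DIM('a) - 1) / 2) / r ^ n) * p y"
proof -
  have "p y = p (norm y *\<^sub>R sgn y)" using y by (simp add: sgn_div_norm)
  also have "\<dots> = of_real (norm y ^ n) * p (sgn y)"
    using p unfolding homogeneous_harmonic_polynomial_def by blast
  finally show ?thesis
    using y by (simp add: ball_eigenfunction_def Y norm_sgn power_divide)
qed

section \<open>The EMP matrix of the ball\<close>

theorem theorem4p1:
  fixes r\<^sub>o \<sigma> :: real and n :: nat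
    and V :: "'a::euclidean_space \<Rightarrow> 'a"
    and Y :: "nat \<Rightarrow> nat \<Rightarrow> 'a \<Rightarrow> complex"
    and \<alpha> :: "nat \<Rightarrow> nat \<Rightarrow> complex"
  assumes dim: "DIM('a) \<ge> 2"
    and radius: "r\<^sub>o > 0"
    and basis: "spherical_harmonics_basis Y"
    and field: "V \<in> Sobolev_infinity 3 (ball 0 r\<^sub>o)"
    and sigma: "\<sigma> = real n / r\<^sub>o"
    and eigenvalue: "Steklov_eigenvalue (ball (0::'a) r\<^sub>o) sgn \<sigma>"
    and expansion: "Fourier_Laplace_expansion Y \<alpha>
                      (\<lambda>\<theta>. complex_of_real (ball_normal_component r\<^sub>o V \<theta>))"
  shows "\<forall>i\<in>{1..harmonics_dim TYPE('a) n}. \<forall>j\<in>{1..harmonics_dim TYPE('a) n}.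
           ball_EMP_matrix r\<^sub>o V \<sigma> (ball_eigenfunction Y r\<^sub>o n) i j =
           (\<Sum>l\<in>{l. l \<le> 2 * n \<and> even l}. \<Sum>m=1..harmonics_dim TYPE('a) l.
              \<alpha> l m * complex_of_real (EMP_coeff DIM('a) n l r\<^sub>o) *
              (LINT \<theta>|sphere_measure 1. Y n i \<theta> * cnj (Y n j \<theta>) * Y l m \<theta>))"
proof (intro ballI)
  fix i j assume i: "i \<in> {1..harmonics_dim TYPE('a) n}" and j: "j \<in> {1..harmonics_dim TYPE('a) n}"
  let ?v = "\<lambda>\<theta>. complex_of_real (ball_normal_component r\<^sub>o V \<theta>)"
  let ?E = "\<lambda>l. complex_of_real (EMP_coeff DIM('a) n l r\<^sub>o)"
  let ?N = "\<lambda>l. harmonics_dim TYPE('a) l"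
  have Yin: "Y l m \<in> spherical_harmonics l" if "m \<in> {1..?N l}" for l m
    using basis that by (simp add: spherical_harmonics_basis_def)
  obtain p where p: "homogeneous_harmonic_polynomial n p"
    and Yi: "Y n i = (\<lambda>x. if x \<in> sphere 0 1 then p x else 0)"
    using Yin[OF i] by (auto simp: spherical_harmonics_def)
  obtain p' where p': "homogeneous_harmonic_polynomial n p'"
    and Yj: "Y n j = (\<lambda>x. if x \<in> sphere 0 1 then p' x else 0)"
    using Yin[OF j] by (auto simp: spherical_harmonics_def)
  define q where "q x = cnj (p' x)" for x
  have q: "homogeneous_harmonic_polynomial n q"
    using p' unfolding q_def
    by (auto simp: homogeneous_harmonic_polynomial_def laplacian_cnj polynomial_function_cnj)
  have "homogeneous_polynomial (n + n) (\<lambda>x. p x * q x)"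
    using p q by (intro homogeneous_polynomial_mult) (auto simp: homogeneous_harmonic_polynomial_iff)
  then have "homogeneous_polynomial (2 * n) (\<lambda>x. p x * q x)" by (simp add: mult_2)
  then obtain h where h: "\<And>k. k \<le> n \<Longrightarrow> homogeneous_harmonic_polynomial (2 * n - 2 * k) (h k)"
    and pq: "\<And>x. p x * q x = (\<Sum>k\<le>n. norm_sq x ^ k * h k x)"
    using Almansi_decomposition[of "2 * n"] by auto
  define H where "H k x = (if x \<in> sphere 0 1 then h k x else 0)" for k x
  have H: "H k \<in> spherical_harmonics (2 * n - 2 * k)" if "k \<le> n" for k
    unfolding spherical_harmonics_def H_def using h[OF that] by blast
  have YH: "Y n i \<theta> * cnj (Y n j \<theta>) = (\<Sum>k\<le>n. H k \<theta>)" if "\<theta> \<in> sphere 0 1" for \<theta>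
  proof -
    have "norm_sq \<theta> = 1" using that by (simp add: dot_square_norm)
    with that show ?thesis using pq[of \<theta>] by (simp add: Yi Yj q_def H_def)
  qed

  \<comment> \<open>Only the component of degree l of the product sees a basis function of degree l.\<close>
  have coeff: "(LINT \<theta>|sphere_measure 1. Y n i \<theta> * cnj (Y n j \<theta>) * Y (2 * n - 2 * k) m \<theta>) =
      (LINT \<theta>|sphere_measure 1. H k \<theta> * Y (2 * n - 2 * k) m \<theta>)"
    if k: "k \<le> n" and m: "m \<in> {1..?N (2 * n - 2 * k)}" for k m
  proof -
    let ?Y = "Y (2 * n - 2 * k) m"
    have "(LINT \<theta>|sphere_measure 1. Y n i \<theta> * cnj (Y n j \<theta>) * ?Y \<theta>) =
        (LINT \<theta>|sphere_measure 1. (\<Sum>k'\<le>n. H k' \<theta> * ?Y \<theta>))"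
      by (intro Bochner_Integration.integral_cong)
        (auto simp: space_sphere_measure YH sum_distrib_right)
    also have "\<dots> = (\<Sum>k'\<le>n. LINT \<theta>|sphere_measure 1. H k' \<theta> * ?Y \<theta>)"
      by (intro Bochner_Integration.integral_sum integrable_sphere_measure_continuous_on
          continuous_intros continuous_on_spherical_harmonics[OF H]
          continuous_on_spherical_harmonics[OF Yin[OF m]]) auto
    also have "\<dots> = (\<Sum>k'\<le>n. if k' = k then LINT \<theta>|sphere_measure 1. H k' \<theta> * ?Y \<theta> else 0)"
      using k by (intro sum.cong refl) (auto intro!: spherical_harmonics_orthogonal[OF basis _ H Yin[OF m]])
    also have "\<dots> = (LINT \<theta>|sphere_measure 1. H k \<theta> * ?Y \<theta>)" using k by simp
    finally show ?thesis .
  qed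
  have even: "2 * n - 2 * (n - l div 2) = l" if "l \<le> 2 * n" "even l" for l
    using that by (auto elim!: evenE)
  have "(\<Sum>l\<in>{l. l \<le> 2 * n \<and> even l}. \<Sum>m=1..?N l.
      \<alpha> l m * ?E l * (LINT \<theta>|sphere_measure 1. Y n i \<theta> * cnj (Y n j \<theta>) * Y l m \<theta>)) =
    (\<Sum>k\<le>n. \<Sum>m=1..?N (2 * n - 2 * k). \<alpha> (2 * n - 2 * k) m * ?E (2 * n - 2 * k) *
      (LINT \<theta>|sphere_measure 1. Y n i \<theta> * cnj (Y n j \<theta>) * Y (2 * n - 2 * k) m \<theta>))"
    by (rule sum.reindex_bij_witness[where i = "\<lambda>k. 2 * n - 2 * k" and j = "\<lambda>l. n - l div 2"])
      (auto simp: even)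
  also have "\<dots> = (\<Sum>k\<le>n. ?E (2 * n - 2 * k) * (\<Sum>m=1..?N (2 * n - 2 * k).
      \<alpha> (2 * n - 2 * k) m * (LINT \<theta>|sphere_measure 1. H k \<theta> * Y (2 * n - 2 * k) m \<theta>)))"
    unfolding sum_distrib_left
    by (intro sum.cong refl, subst coeff) (simp_all add: mult_ac)
  also have "\<dots> = (\<Sum>k\<le>n. ?E (2 * n - 2 * k) * (LINT \<theta>|sphere_measure 1. H k \<theta> * ?v \<theta>))"
    by (intro sum.cong refl arg_cong2[where f = "(*)"])
      (simp add: integral_mult_Fourier_Laplace_expansion[OF basis expansion H])
  finally have rhs: "(\<Sum>l\<in>{l. l \<le> 2 * n \<and> even l}. \<Sum>m=1..?N l.
      \<alpha> l m * ?E l * (LINT \<theta>|sphere_measure 1. Y n i \<theta> * cnj (Y n j \<theta>) * Y l m \<theta>)) =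
    (\<Sum>k\<le>n. ?E (2 * n - 2 * k) * (LINT \<theta>|sphere_measure 1. H k \<theta> * ?v \<theta>))" .

  \<comment> \<open>On the sphere of radius \<open>r\<^sub>o\<close> the normalization of the two eigenfunctions, together with the
    degree of the polynomials, cancels the scaling factor of the surface measure.\<close>
  define c where "c = r\<^sub>o powr (- (real DIM('a) - 1) / 2) / r\<^sub>o ^ n"
  have ui: "ball_eigenfunction Y r\<^sub>o n i y = of_real c * p y"
    and uj: "cnj (ball_eigenfunction Y r\<^sub>o n j y) = of_real c * q y" if "y \<noteq> 0" for y
    using ball_eigenfunction_eq_polynomial[OF radius that p, of Y i, OF Yi]
      ball_eigenfunction_eq_polynomial[OF radius that p', of Y j, OF Yj]
    by (simp_all add: c_def q_def)
  have c2: "c\<^sup>2 * r\<^sub>o ^ (2 * n) = 1 / r\<^sub>o ^ (DIM('a) - 1)"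
  proof -
    have "(r\<^sub>o powr (- (real DIM('a) - 1) / 2))\<^sup>2 = r\<^sub>o powr (- real (DIM('a) - 1))"
      using dim radius by (simp add: power2_eq_square of_nat_diff flip: powr_add)
    also have "\<dots> = 1 / r\<^sub>o ^ (DIM('a) - 1)"
      by (simp only: powr_minus powr_realpow[OF radius] inverse_eq_divide)
    finally show ?thesis
      using radius by (simp add: c_def power_divide power_mult power2_eq_square power_mult_distrib)
  qed
  define G where "G \<theta> = (\<Sum>k\<le>n. ?E (2 * n - 2 * k) * (H k \<theta> * ?v \<theta>))" for \<theta>
  have integrand: "((\<Sum>b\<in>Basis. tangential_gradient sgn (ball_eigenfunction Y r\<^sub>o n i) x b *
        tangential_gradient sgn (\<lambda>y. cnj (ball_eigenfunction Y r\<^sub>o n j y)) x b)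
      - of_real (\<sigma>\<^sup>2 + \<sigma> * ((real DIM('a) - 1) / r\<^sub>o)) * ball_eigenfunction Y r\<^sub>o n i x *
        cnj (ball_eigenfunction Y r\<^sub>o n j x)) *
      of_real (continuous_representative (ball 0 r\<^sub>o) V x \<bullet> sgn x) =
    of_real (1 / r\<^sub>o ^ (DIM('a) - 1)) * G (x /\<^sub>R r\<^sub>o)"
    if x: "x \<in> sphere 0 r\<^sub>o" for x
  proof -
    have nx: "norm x = r\<^sub>o" and x0: "x \<noteq> 0" using x radius by auto
    have pf: "polynomial_function p" "polynomial_function q"
      using p q by (auto simp: homogeneous_harmonic_polynomial_def)
    have tg: "tangential_gradient sgn (ball_eigenfunction Y r\<^sub>o n i) x b = of_real c * tangential_gradient sgn p x b"
      "tangential_gradient sgn (\<lambda>y. cnj (ball_eigenfunction Y r\<^sub>o n j y)) x b = of_real c * tangential_gradient sgn q x b" for b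
      using tangential_gradient_cong_off_origin[OF ui pf(1) x0]
        tangential_gradient_cong_off_origin[OF uj pf(2) x0] by simp_all
    have v: "complex_of_real (continuous_representative (ball 0 r\<^sub>o) V x \<bullet> sgn x) = ?v (x /\<^sub>R r\<^sub>o)"
      using radius nx by (simp add: ball_normal_component_def sgn_div_norm)
    have "(\<Sum>b\<in>Basis. tangential_gradient sgn (ball_eigenfunction Y r\<^sub>o n i) x b *
        tangential_gradient sgn (\<lambda>y. cnj (ball_eigenfunction Y r\<^sub>o n j y)) x b)
      - of_real (\<sigma>\<^sup>2 + \<sigma> * ((real DIM('a) - 1) / r\<^sub>o)) * ball_eigenfunction Y r\<^sub>o n i x *
        cnj (ball_eigenfunction Y r\<^sub>o n j x) =
      of_real (c\<^sup>2) * ((\<Sum>b\<in>Basis. tangential_gradient sgn p x b * tangential_gradient sgn q x b)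
      - of_real ((real n / r\<^sub>o)\<^sup>2 + real n / r\<^sub>o * ((real DIM('a) - 1) / r\<^sub>o)) * (p x * q x))"
      unfolding tg ui[OF x0] uj[OF x0] sigma
      by (simp add: right_diff_distrib sum_distrib_left power2_eq_square mult_ac)
    also have "\<dots> = of_real (c\<^sup>2 * r\<^sub>o ^ (2 * n)) * (\<Sum>k\<le>n. ?E (2 * n - 2 * k) * h k (x /\<^sub>R r\<^sub>o))"
      by (subst EMP_integrand_on_sphere[where h = h, OF p q h pq radius nx]) simp_all
    also have "(\<Sum>k\<le>n. ?E (2 * n - 2 * k) * h k (x /\<^sub>R r\<^sub>o)) = (\<Sum>k\<le>n. ?E (2 * n - 2 * k) * H k (x /\<^sub>R r\<^sub>o))"
      using radius nx by (simp add: H_def)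
    finally show ?thesis unfolding v c2 G_def by (simp only: sum_distrib_right mult.assoc)
  qed
  interpret finite_measure "sphere_measure 1 :: 'a measure"
    by (rule finite_measure_sphere_measure) simp
  have vm: "?v \<in> borel_measurable (sphere_measure 1)"
    and v2: "integrable (sphere_measure 1) (\<lambda>\<theta>. (cmod (?v \<theta>))\<^sup>2)"
    using expansion by (auto simp: Fourier_Laplace_expansion_def)
  have "integrable (sphere_measure 1) (\<lambda>\<theta>. cmod (?v \<theta>))"
    by (rule integral_square_le(1)[OF _ v2]) (use vm in measurable)
  then have vi: "integrable (sphere_measure 1) ?v" using vm by (simp only: integrable_norm_iff)
  have Hv: "integrable (sphere_measure 1) (\<lambda>\<theta>. H k \<theta> * ?v \<theta>)" if "k \<le> n" for k
    by (rule integrable_mult_continuous_on_sphere[OF zero_less_one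
          continuous_on_spherical_harmonics[OF H[OF that]] vi])
  have Gi: "integrable (sphere_measure 1) G"
    unfolding G_def using Hv by (intro Bochner_Integration.integrable_sum integrable_mult_right) auto
  have "ball_EMP_matrix r\<^sub>o V \<sigma> (ball_eigenfunction Y r\<^sub>o n) i j =
      (LINT x|sphere_measure r\<^sub>o. of_real (1 / r\<^sub>o ^ (DIM('a) - 1)) * G (x /\<^sub>R r\<^sub>o))"
    unfolding ball_EMP_matrix_def EMP_matrix_def
    by (intro Bochner_Integration.integral_cong refl integrand) (simp add: space_sphere_measure)
  also have "\<dots> = (LINT \<theta>|sphere_measure 1. G \<theta>)"
    using integral_sphere_measure_unscale[OF radius borel_measurable_integrable[OF Gi]] radius by simp
  also have "\<dots> = (\<Sum>k\<le>n. ?E (2 * n - 2 * k) * (LINT \<theta>|sphere_measure 1. H k \<theta> * ?v \<theta>))"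
    unfolding G_def using Hv by (subst Bochner_Integration.integral_sum) auto
  finally show "ball_EMP_matrix r\<^sub>o V \<sigma> (ball_eigenfunction Y r\<^sub>o n) i j =
      (\<Sum>l\<in>{l. l \<le> 2 * n \<and> even l}. \<Sum>m=1..?N l.
        \<alpha> l m * ?E l * (LINT \<theta>|sphere_measure 1. Y n i \<theta> * cnj (Y n j \<theta>) * Y l m \<theta>))"
    unfolding rhs .
qed

end
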